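(* Let $(X,\mathcal{B})$ be a standard Borel space. For every Polish topology $\tau$ on $X$ that generates $\mathcal{B}$, there are $\mathcal{E}_\tau(X)$-measurable functions $\{\Xi_A:A\in\mathcal{B}\}$ of the form $\Xi_A:\mathbf{F}_\tau(X)\to\mathbb{Z}_{\ge0}\cup\{\infty\}$ with the following property: for every non-atomic Borel measure $\mu$ on $(X,\mathcal{B})$ that is $\tau$-locally finite, there exists a unique random closed set $\mu_\tau$ on $(\mathbf{F}_\tau(X),\mathcal{E}_\tau(X))$ with respect to which $\{\Xi_A:A\in\mathcal{B}\}$ forms a Poisson point process with base space $(X,\mathcal{B},\mu)$.
   Context: For a Polish topology $\tau$ on $X$ generating $\mathcal{B}$, $\mathbf{F}_\tau(X)=\{F\subset X:X\setminus F\in\tau\}$ is the set of $\tau$-closed sets, and $\mathcal{E}_\tau(X)$ (the Effros $\sigma$-algebra) is generated by the sets $B_O=\{F\in\mathbf{F}_\tau(X):F\cap O\ne\emptyset\}$, $O\in\tau$; this is a standard Borel space. A random closed set is a probability measure on $(\mathbf{F}_\tau(X),\mathcal{E}_\tau(X))$. A measure is $\tau$-locally finite if every point of $X$ has a $\tau$-neighborhood of finite measure. For $0\le\alpha\le\infty$, $\mathrm{Poiss}(\alpha)$ is the Poisson distribution with mean $\alpha$; for $\alpha\in\{0,\infty\}$ it is the distribution of the constant $\alpha$. A collection $\{P_A:A\in\mathcal{B}\}$ of random variables on a probability space $(\Omega,\mathcal{F},\mathbb{P})$ is a Poisson point process with base space $(X,\mathcal{B},\mu)$ if $P_A$ has distribution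 $\mathrm{Poiss}(\mu(A))$ for every $A\in\mathcal{B}$, and $P_{A\cup B}=P_A+P_B$ $\mathbb{P}$-a.s. whenever $A,B\in\mathcal{B}$ are disjoint. *)

theory Defs
  imports "HOL-Analysis.Analysis" "HOL-Probability.Probability"
begin

definition polish_topology :: "'a topology \<Rightarrow> bool" where
  "polish_topology \<tau> \<longleftrightarrow> completely_metrizable_space \<tau> \<and> separable_space \<tau>"

(* A measurable space is represented by a measure M of which only space M and sets M matter. *)
definition generates_sigma_algebra :: "'a topology \<Rightarrow> 'a measure \<Rightarrow> bool" where
  "generates_sigma_algebra \<tau> M \<longleftrightarrow>
     topspace \<tau> = space M \<and> sets M = sigma_sets (space M) {U. openin \<tau> U}"

definition standard_borel :: "'a measure \<Rightarrow> bool" where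
  "standard_borel M \<longleftrightarrow> (\<exists>\<tau>. polish_topology \<tau> \<and> generates_sigma_algebra \<tau> M)"

definition effros :: "'a topology \<Rightarrow> 'a set measure" where
  "effros \<tau> = sigma {F. closedin \<tau> F}
     {B. \<exists>U. openin \<tau> U \<and> B = {F. closedin \<tau> F \<and> F \<inter> U \<noteq> {}}}"

lemma space_effros [simp]: "space (effros \<tau>) = {F. closedin \<tau> F}"
  unfolding effros_def by (rule space_measure_of) auto

lemma sets_effros:
  "sets (effros \<tau>) = sigma_sets {F. closedin \<tau> F}
     {B. \<exists>U. openin \<tau> U \<and> B = {F. closedin \<tau> F \<and> F \<inter> U \<noteq> {}}}"
  unfolding effros_def by (rule sets_measure_of) auto

definition random_closed_set :: "'a topology \<Rightarrow> 'a set measure \<Rightarrow> bool" where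
  "random_closed_set \<tau> R \<longleftrightarrow> sets R = sets (effros \<tau>) \<and> prob_space R"

(* Neighbourhoods are taken open, so that they are measurable and emeasure is meaningful on them. *)
definition locally_finite_measure :: "'a topology \<Rightarrow> 'a measure \<Rightarrow> bool" where
  "locally_finite_measure \<tau> N \<longleftrightarrow>
     (\<forall>x\<in>topspace \<tau>. \<exists>U. openin \<tau> U \<and> x \<in> U \<and> emeasure N U < \<infinity>)"

definition measure_atom :: "'a measure \<Rightarrow> 'a set \<Rightarrow> bool" where
  "measure_atom N A \<longleftrightarrow> A \<in> sets N \<and> emeasure N A > 0 \<and>
     (\<forall>B\<in>sets N. B \<subseteq> A \<longrightarrow> emeasure N B = 0 \<or> emeasure N (A - B) = 0)"

definition non_atomic :: "'a measure \<Rightarrow> bool" where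
  "non_atomic N \<longleftrightarrow> (\<nexists>A. measure_atom N A)"

(* The library's poisson_pmf is only specified for a positive real rate. *)
definition Poiss :: "ennreal \<Rightarrow> enat pmf" where
  "Poiss \<alpha> =
     (if \<alpha> = 0 then return_pmf 0
      else if \<alpha> = \<infinity> then return_pmf \<infinity>
      else map_pmf enat (poisson_pmf (enn2real \<alpha>)))"

(* P is a family of random variables, indexed by sets N, on the probability space R.
   Independence over disjoint sets is deliberately not part of the definition. *)
definition poisson_point_process ::
    "'o measure \<Rightarrow> 'a measure \<Rightarrow> ('a set \<Rightarrow> 'o \<Rightarrow> enat) \<Rightarrow> bool" where
  "poisson_point_process R N P \<longleftrightarrow>
     prob_space R \<and>
     (\<forall>A\<in>sets N. P A \<in> measurable R (count_space UNIV)) \<and>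
     (\<forall>A\<in>sets N. distr R (count_space UNIV) (P A) = measure_pmf (Poiss (emeasure N A))) \<and>
     (\<forall>A\<in>sets N. \<forall>B\<in>sets N. A \<inter> B = {} \<longrightarrow>
        (AE \<omega> in R. P (A \<union> B) \<omega> = P A \<omega> + P B \<omega>))"

end

theory Submission
  imports Defs "HOL-Complex_Analysis.Cauchy_Integral_Formula"
begin

text \<open>The counting variables are built so that they see a closed set only through its isolated points.
Counting \<open>F \<inter> A\<close> itself is not possible: for Borel \<open>A\<close>, \<open>F \<inter> A \<noteq> {}\<close> is in general only an
analytic condition on \<open>F\<close>, and in the Baire space even the family of discrete closed sets is not
Effros-measurable. That a point of \<open>F\<close> is isolated, on the other hand, is witnessed by a member \<open>V\<close>
of a countable base with \<open>F \<inter> V\<close> a singleton. For fixed \<open>V\<close> the closed sets with that property form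
a measurable family, and on it the single point of \<open>F \<inter> V\<close> depends measurably on \<open>F\<close>. So
\<^term>\<open>point_count \<tau> A F\<close>, which for the sets described next is the number of isolated points of \<open>F\<close>
in \<open>A\<close>, is measurable (\<open>measurable_point_count\<close>).

Isolated points alone do not determine \<open>F\<close>: adjoining a fixed null perfect set to a
Poisson set on the line changes the law of the random set but not the counts. Hence \<open>point_count\<close>
takes the value 1 for every \<open>A\<close>, the empty set included, whenever the isolated points of \<open>F\<close> are not
dense in \<open>F\<close>. As the count of the empty set has to vanish almost surely, under any random closed set
that makes the counts a Poisson process the isolated points are almost surely dense. Then, for
open \<open>U\<close>, missing \<open>U\<close> is almost surely the same as having count 0 in \<open>U\<close>, and this has a prescribed
probability. The events of missing an open set are closed under intersection and generate the Effros
\<open>\<sigma>\<close>-algebra, so the law is unique (\<open>poisson_process_unique\<close>).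

For existence (\<open>poisson_process_exists\<close>), local finiteness and a countable base give a cover by
countably many open sets of finite measure. Removing from each member the earlier ones partitions the
space into cells, and in each cell a Poisson number of independent points is thrown
(\<open>poisson_sample\<close>); the random set is the union over the cells. Every member of the cover meets only
finitely many cells and hence only finitely many points, so each realisation is closed and
consists of isolated points, and \<open>point_count\<close> really counts its points. Non-atomicity makes the
points of one cell almost surely distinct. The distribution of a count is identified by its
probability generating function, with \<open>s ^ \<infinity> = 0\<close> for \<open>s < 1\<close>: on a cell it is
\<open>exp (- (1 - s) \<mu>(A \<inter> X))\<close>, independence turns the union into a product, and dominated convergence
passes to infinitely many cells. The case \<open>\<mu>(A) = \<infinity>\<close> is the one where the limit is 0.\<close>

section \<open>Counting the isolated points of a closed set\<close>

definition ecard :: "'a set \<Rightarrow> enat" where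
  "ecard S = (if finite S then enat (card S) else \<infinity>)"

lemma ecard_eq_0_iff: "ecard S = 0 \<longleftrightarrow> S = {}"
  by (auto simp: ecard_def zero_enat_def)

lemma ecard_Un_disjoint: "S \<inter> T = {} \<Longrightarrow> ecard (S \<union> T) = ecard S + ecard T"
  by (auto simp: ecard_def card_Un_disjoint)

lemma ecard_ge_iff: "enat m \<le> ecard S \<longleftrightarrow> (\<exists>T\<subseteq>S. finite T \<and> card T = m)"
proof (cases "finite S")
  case True
  then show ?thesis
    by (auto simp: ecard_def intro: card_mono finite_subset dest: obtain_subset_with_card_n)
next
  case False
  then show ?thesis
    using infinite_arbitrarily_large[OF False, of m] by (auto simp: ecard_def)
qed

lemma measurable_enatI:
  fixes f :: "'a \<Rightarrow> enat"
  assumes [measurable]: "\<And>m. Measurable.pred M (\<lambda>x. enat m \<le> f x)"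
  shows "f \<in> measurable M (count_space UNIV)"
proof (rule measurable_count_space_eq2_countable[THEN iffD2], intro conjI ballI)
  fix n :: enat
  have "{x \<in> space M. f x = n} \<in> sets M"
  proof (cases n)
    case (enat m)
    have "{x \<in> space M. enat m \<le> f x \<and> \<not> enat (Suc m) \<le> f x} \<in> sets M"
      by measurable
    also have "{x \<in> space M. enat m \<le> f x \<and> \<not> enat (Suc m) \<le> f x} = {x \<in> space M. f x = n}"
    proof -
      have "enat m \<le> k \<and> \<not> enat (Suc m) \<le> k \<longleftrightarrow> k = enat m" for k
        by (cases k) auto
      then show ?thesis by (simp add: enat)
    qed
    finally show ?thesis .
  next
    case infinity
    have "{x \<in> space M. \<forall>m. enat m \<le> f x} \<in> sets M"
      by measurable
    also have "{x \<in> space M. \<forall>m. enat m \<le> f x} = {x \<in> space M. f x = n}"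
    proof -
      have "(\<forall>m. enat m \<le> k) \<longleftrightarrow> k = \<infinity>" for k
        by (cases k) (auto intro: exI[of _ "Suc _"] simp: not_le)
      then show ?thesis by (simp add: infinity)
    qed
    finally show ?thesis .
  qed
  then show "f -` {n} \<inter> space M \<in> sets M"
    by (simp add: vimage_def Int_def conj_commute)
qed auto

definition isolated_points :: "'a topology \<Rightarrow> 'a set \<Rightarrow> 'a set" where
  "isolated_points \<tau> F = {x. \<exists>U. openin \<tau> U \<and> F \<inter> U = {x}}"

definition isolated_points_dense :: "'a topology \<Rightarrow> 'a set \<Rightarrow> bool" where
  "isolated_points_dense \<tau> F \<longleftrightarrow>
     (\<forall>U. openin \<tau> U \<and> F \<inter> U \<noteq> {} \<longrightarrow> isolated_points \<tau> F \<inter> U \<noteq> {})"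

text \<open>The value 1 on the sets whose isolated points are not dense, also for \<open>A = {}\<close>, is what makes these
sets negligible under every Poisson process: see \<open>poisson_process_AE_isolated_points_dense\<close>.\<close>
definition point_count :: "'a topology \<Rightarrow> 'a set \<Rightarrow> 'a set \<Rightarrow> enat" where
  "point_count \<tau> A F =
     (if isolated_points_dense \<tau> F then ecard (isolated_points \<tau> F \<inter> A) else 1)"

lemma isolated_points_subset: "isolated_points \<tau> F \<subseteq> F"
  by (auto simp: isolated_points_def)

lemma point_count_eq_0_iff:
  assumes "isolated_points_dense \<tau> F" "openin \<tau> U"
  shows "point_count \<tau> U F = 0 \<longleftrightarrow> F \<inter> U = {}"
  using assms isolated_points_subset[of \<tau> F]
  by (auto simp: point_count_def ecard_eq_0_iff isolated_points_dense_def)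

lemma hit_in_effros: "openin \<tau> U \<Longrightarrow> {F. closedin \<tau> F \<and> F \<inter> U \<noteq> {}} \<in> sets (effros \<tau>)"
  unfolding sets_effros by (rule sigma_sets.Basic) auto

lemma pred_hit [measurable]: "openin \<tau> U \<Longrightarrow> Measurable.pred (effros \<tau>) (\<lambda>F. F \<inter> U \<noteq> {})"
  using hit_in_effros[of \<tau> U] by (simp add: pred_def Int_def cong: conj_cong)

lemma pred_miss [measurable]: "openin \<tau> U \<Longrightarrow> Measurable.pred (effros \<tau>) (\<lambda>F. F \<inter> U = {})"
  using pred_intros_logic(2)[OF pred_hit[of \<tau> U]] by simp

locale countably_based_hausdorff =
  fixes \<tau> :: "'a topology" and b :: "nat \<Rightarrow> 'a set"
  assumes open_base: "openin \<tau> (b n)"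
    and base: "openin \<tau> U \<Longrightarrow> x \<in> U \<Longrightarrow> \<exists>n. x \<in> b n \<and> b n \<subseteq> U"
    and hausdorff: "Hausdorff_space \<tau>"
begin

lemma isolated_points_base: "isolated_points \<tau> F = {x. \<exists>n. F \<inter> b n = {x}}"
proof -
  have "(\<exists>U. openin \<tau> U \<and> F \<inter> U = {x}) \<longleftrightarrow> (\<exists>n. F \<inter> b n = {x})" for x
  proof
    assume "\<exists>U. openin \<tau> U \<and> F \<inter> U = {x}"
    then obtain U where U: "openin \<tau> U" "F \<inter> U = {x}" by blast
    then have "x \<in> U" by blast
    from base[OF U(1) this] obtain n where "x \<in> b n" "b n \<subseteq> U" by blast
    with U have "F \<inter> b n = {x}" by blast
    then show "\<exists>n. F \<inter> b n = {x}" ..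
  next
    show "\<exists>n. F \<inter> b n = {x} \<Longrightarrow> \<exists>U. openin \<tau> U \<and> F \<inter> U = {x}"
      using open_base by auto
  qed
  then show ?thesis
    by (simp add: isolated_points_def)
qed

text \<open>Two points of \<open>F \<inter> b n\<close> are separated by disjoint members of the base. The right-hand side is a
countable combination of the generators of the Effros \<open>\<sigma>\<close>-algebra.\<close>
lemma singleton_trace_iff:
  assumes "closedin \<tau> F"
  shows "(\<exists>x. F \<inter> b n = {x}) \<longleftrightarrow> F \<inter> b n \<noteq> {} \<and>
    (\<forall>i j. b i \<inter> b j = {} \<longrightarrow> F \<inter> (b n \<inter> b i) = {} \<or> F \<inter> (b n \<inter> b j) = {})"
    (is "?L \<longleftrightarrow> ?R")
proof
  assume ?L
  then obtain x where x: "F \<inter> b n = {x}" by blast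
  then have "F \<inter> (b n \<inter> W) = {x} \<inter> W" for W by (simp flip: Int_assoc)
  with x show ?R by auto
next
  assume R: ?R
  then obtain x where x: "x \<in> F \<inter> b n" by auto
  have "y = x" if y: "y \<in> F \<inter> b n" for y
  proof (rule ccontr)
    assume "y \<noteq> x"
    moreover have "x \<in> topspace \<tau>" "y \<in> topspace \<tau>"
      using x y openin_subset[OF open_base[of n]] by auto
    ultimately obtain U V where UV: "openin \<tau> U" "openin \<tau> V" "x \<in> U" "y \<in> V" "disjnt U V"
      using hausdorff unfolding Hausdorff_space_def by metis
    obtain i j where "x \<in> b i" "b i \<subseteq> U" "y \<in> b j" "b j \<subseteq> V"
      using base UV by metis
    moreover from this have "b i \<inter> b j = {}"
      using UV(5) by (auto simp: disjnt_def)
    ultimately have "x \<in> F \<inter> (b n \<inter> b i)" "y \<in> F \<inter> (b n \<inter> b j)" "b i \<inter> b j = {}"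
      using x y by auto
    with R show False by (metis empty_iff)
  qed
  with x have "F \<inter> b n = {x}" by blast
  then show ?L ..
qed

lemma pred_singleton_trace [measurable]:
  "Measurable.pred (effros \<tau>) (\<lambda>F. \<exists>x. F \<inter> b n = {x})"
proof -
  have [measurable]: "openin \<tau> (b i \<inter> b j)" "openin \<tau> (b i)" for i j
    using open_base by auto
  have "Measurable.pred (effros \<tau>) (\<lambda>F. F \<inter> b n \<noteq> {} \<and>
    (\<forall>i j. b i \<inter> b j = {} \<longrightarrow> F \<inter> (b n \<inter> b i) = {} \<or> F \<inter> (b n \<inter> b j) = {}))"
    by measurable
  then show ?thesis
    by (rule measurable_cong[THEN iffD1, rotated]) (simp add: singleton_trace_iff)
qed

text \<open>On the sets with exactly one point in \<open>b n\<close>, this point is a measurable function of the set; for open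
\<open>A\<close> this is the statement that \<open>F\<close> hits \<open>b n \<inter> A\<close>.\<close>
lemma pred_singleton_trace_in:
  assumes "A \<in> sigma_sets (topspace \<tau>) {U. openin \<tau> U}"
  shows "Measurable.pred (effros \<tau>) (\<lambda>F. \<exists>x\<in>A. F \<inter> b n = {x})"
  using assms
proof induction
  case (Basic U)
  then have "openin \<tau> (b n \<inter> U)" using open_base by auto
  note [measurable] = pred_hit[OF this]
  have "Measurable.pred (effros \<tau>) (\<lambda>F. (\<exists>x. F \<inter> b n = {x}) \<and> F \<inter> (b n \<inter> U) \<noteq> {})"
    by measurable
  moreover have "(\<exists>x. S = {x}) \<and> S \<inter> U \<noteq> {} \<longleftrightarrow> (\<exists>x\<in>U. S = {x})" for S
    by auto
  ultimately show ?case
    by (simp only: Int_assoc[symmetric])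
next
  case Empty
  then show ?case by simp
next
  case (Compl A)
  note [measurable] = Compl.IH
  have "Measurable.pred (effros \<tau>) (\<lambda>F. (\<exists>x. F \<inter> b n = {x}) \<and> \<not> (\<exists>x\<in>A. F \<inter> b n = {x}))"
    by measurable
  moreover have "(\<exists>x. S = {x}) \<and> \<not> (\<exists>x\<in>A. S = {x}) \<longleftrightarrow> (\<exists>x\<in>topspace \<tau> - A. S = {x})"
    if "S \<subseteq> topspace \<tau>" for S
    using that by auto
  moreover have "F \<inter> b n \<subseteq> topspace \<tau>" for F
    using openin_subset[OF open_base[of n]] by blast
  ultimately show ?case
    by simp
next
  case (Union A)
  note [measurable] = Union.IH
  have "Measurable.pred (effros \<tau>) (\<lambda>F. \<exists>i::nat. \<exists>x\<in>A i. F \<inter> b n = {x})"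
    by measurable
  then show ?case by simp
qed

lemma pred_isolated_points_dense [measurable]:
  "Measurable.pred (effros \<tau>) (isolated_points_dense \<tau>)"
proof -
  have [measurable]: "openin \<tau> (b i)" for i
    using open_base by auto
  have "isolated_points_dense \<tau> F \<longleftrightarrow>
      (\<forall>n. F \<inter> b n = {} \<or> (\<exists>m. b m \<subseteq> b n \<and> (\<exists>x. F \<inter> b m = {x})))" (is "_ \<longleftrightarrow> ?R") for F
  proof
    assume I: "isolated_points_dense \<tau> F"
    show ?R
    proof
      fix n
      show "F \<inter> b n = {} \<or> (\<exists>m. b m \<subseteq> b n \<and> (\<exists>x. F \<inter> b m = {x}))"
      proof (cases "F \<inter> b n = {}")
        case False
        with I open_base[of n] have "isolated_points \<tau> F \<inter> b n \<noteq> {}"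
          unfolding isolated_points_dense_def by simp
        then obtain x where x: "x \<in> isolated_points \<tau> F" "x \<in> b n" by blast
        obtain k where k: "F \<inter> b k = {x}"
          using x(1) by (auto simp: isolated_points_base)
        with x(2) have "x \<in> b n \<inter> b k" by blast
        from base[OF openin_Int[OF open_base open_base] this]
        obtain m where m: "x \<in> b m" "b m \<subseteq> b n \<inter> b k" by blast
        with k have "b m \<subseteq> b n" "F \<inter> b m = {x}" by blast+
        then show ?thesis by auto
      qed simp
    qed
  next
    assume R: ?R
    show "isolated_points_dense \<tau> F"
      unfolding isolated_points_dense_def
    proof (intro allI impI, elim conjE)
      fix U assume "openin \<tau> U" "F \<inter> U \<noteq> {}"
      then obtain y where y: "y \<in> F" "y \<in> U" by blast
      from base[OF \<open>openin \<tau> U\<close> y(2)] obtain n where n: "y \<in> b n" "b n \<subseteq> U" by blast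
      with y have "F \<inter> b n \<noteq> {}" by blast
      with R obtain m x where mx: "b m \<subseteq> b n" "F \<inter> b m = {x}" by metis
      then have "x \<in> isolated_points \<tau> F" by (auto simp: isolated_points_base)
      moreover have "x \<in> U" using mx n by blast
      ultimately show "isolated_points \<tau> F \<inter> U \<noteq> {}" by blast
    qed
  qed
  then have "isolated_points_dense \<tau> =
      (\<lambda>F. \<forall>n. F \<inter> b n = {} \<or> (\<exists>m. b m \<subseteq> b n \<and> (\<exists>x. F \<inter> b m = {x})))"
    by (rule ext)
  then show ?thesis by simp
qed

text \<open>Counting is reduced to countably many events by naming isolated points through base sets that
isolate them. Two indices name different points iff the corresponding base sets have no common point
in \<open>F\<close>, which is again an event about \<open>F\<close> hitting an open set.\<close>
lemma ecard_isolated_points_ge_iff: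
  "enat m \<le> ecard (isolated_points \<tau> F \<inter> A) \<longleftrightarrow>
     (\<exists>J\<in>{J. finite J \<and> card J = m}. (\<forall>n\<in>J. \<exists>x\<in>A. F \<inter> b n = {x}) \<and>
        (\<forall>n\<in>J. \<forall>k\<in>J. n \<noteq> k \<longrightarrow> F \<inter> (b n \<inter> b k) = {}))"
    (is "_ \<longleftrightarrow> ?R")
proof
  assume "enat m \<le> ecard (isolated_points \<tau> F \<inter> A)"
  then obtain T where T: "T \<subseteq> isolated_points \<tau> F \<inter> A" "finite T" "card T = m"
    by (auto simp: ecard_ge_iff)
  then have "\<forall>x\<in>T. \<exists>n. F \<inter> b n = {x}"
    by (auto simp: isolated_points_base)
  then obtain n where n: "\<And>x. x \<in> T \<Longrightarrow> F \<inter> b (n x) = {x}" by metis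
  then have "inj_on n T" by (metis inj_onI singleton_inject)
  then have "finite (n ` T)" "card (n ` T) = m"
    using T by (auto simp: card_image)
  moreover have "\<forall>k\<in>n ` T. \<exists>x\<in>A. F \<inter> b k = {x}"
    using n T(1) by auto
  moreover have "\<forall>i\<in>n ` T. \<forall>k\<in>n ` T. i \<noteq> k \<longrightarrow> F \<inter> (b i \<inter> b k) = {}"
  proof safe
    fix x y z assume xyz: "x \<in> T" "y \<in> T" "n x \<noteq> n y" "z \<in> F" "z \<in> b (n x)" "z \<in> b (n y)"
    then have "z = x" "z = y" using n[of x] n[of y] by auto
    with xyz show "z \<in> {}" by simp
  qed
  ultimately show ?R
    by (intro bexI[of _ "n ` T"]) auto
next
  assume ?R
  then obtain J where J: "finite J" "card J = m" "\<forall>n\<in>J. \<exists>x\<in>A. F \<inter> b n = {x}"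
    and D: "\<forall>n\<in>J. \<forall>k\<in>J. n \<noteq> k \<longrightarrow> F \<inter> (b n \<inter> b k) = {}" by auto
  from J(3) obtain x where x: "\<And>n. n \<in> J \<Longrightarrow> x n \<in> A \<and> F \<inter> b n = {x n}" by metis
  have "inj_on x J"
  proof (rule inj_onI, rule ccontr)
    fix i k assume ik: "i \<in> J" "k \<in> J" "x i = x k" "i \<noteq> k"
    then have "F \<inter> b i = {x k}" "F \<inter> b k = {x k}" using x[of i] x[of k] by auto
    then have "x k \<in> F \<inter> (b i \<inter> b k)" by blast
    with D ik show False by (metis empty_iff)
  qed
  then have "x ` J \<subseteq> isolated_points \<tau> F \<inter> A \<and> finite (x ` J) \<and> card (x ` J) = m"
    using x J(1,2) by (auto simp: card_image isolated_points_base)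
  then show "enat m \<le> ecard (isolated_points \<tau> F \<inter> A)"
    unfolding ecard_ge_iff by blast
qed

lemma measurable_point_count:
  assumes "A \<in> sigma_sets (topspace \<tau>) {U. openin \<tau> U}"
  shows "point_count \<tau> A \<in> measurable (effros \<tau>) (count_space UNIV)"
proof -
  note [measurable] = pred_singleton_trace_in[OF assms]
  have [measurable]: "openin \<tau> (b i \<inter> b j)" for i j
    using open_base by auto
  have "(\<lambda>F. ecard (isolated_points \<tau> F \<inter> A)) \<in> measurable (effros \<tau>) (count_space UNIV)"
  proof (rule measurable_enatI)
    fix m
    have countable_J: "countable {J :: nat set. finite J \<and> card J = m}"
      by (rule countable_subset[OF _ countable_Collect_finite]) auto
    have *: "Measurable.pred (effros \<tau>) (\<lambda>F. (\<forall>n\<in>J. \<exists>x\<in>A. F \<inter> b n = {x}) \<and>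
        (\<forall>n\<in>J. \<forall>k\<in>J. n \<noteq> k \<longrightarrow> F \<inter> (b n \<inter> b k) = {}))" for J
      by (measurable; simp)
    show "Measurable.pred (effros \<tau>) (\<lambda>F. enat m \<le> ecard (isolated_points \<tau> F \<inter> A))"
      using * unfolding ecard_isolated_points_ge_iff pred_def
      by (intro sets.sets_Collect_countable_Ex') (simp_all add: countable_J)
  qed
  then show ?thesis
    unfolding point_count_def[abs_def] by measurable
qed

end

text \<open>The balls of radius \<open>1 / (n + 1)\<close> around the points of a countable dense set form a base.\<close>
lemma polish_countably_based:
  assumes "polish_topology \<tau>"
  obtains b where "countably_based_hausdorff \<tau> b"
proof -
  have met: "metrizable_space \<tau>" and sep: "separable_space \<tau>"
    using assms by (auto simp: polish_topology_def completely_metrizable_imp_metrizable_space)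
  obtain S d where "Metric_space S d" and tau: "\<tau> = Metric_space.mtopology S d"
    using met by (auto simp: metrizable_space_def)
  interpret Metric_space S d by fact
  obtain D where D: "countable D" "D \<subseteq> S" "mtopology closure_of D = S"
    using sep by (auto simp: separable_space_def tau)
  define f where "f = (\<lambda>(x, n::nat). mball x (inverse (real (Suc n))))"
  \<comment> \<open>The empty set is inserted so that the base can be enumerated also when the space is empty.\<close>
  define B where "B = insert {} (f ` (D \<times> UNIV))"
  have B: "countable B" "B \<noteq> {}" and oB: "\<And>V. V \<in> B \<Longrightarrow> openin \<tau> V"
    using D(1) by (auto simp: B_def f_def tau)
  have "\<exists>V\<in>B. x \<in> V \<and> V \<subseteq> U" if U: "openin \<tau> U" "x \<in> U" for U x
  proof -
    from U have "\<exists>r>0. mball x r \<subseteq> U" and xS: "x \<in> S"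
      by (auto simp: tau openin_mtopology)
    then obtain r where r: "r > 0" "mball x r \<subseteq> U" by blast
    obtain n where n: "inverse (real (Suc n)) < r / 2"
      using reals_Archimedean[of "r / 2"] r by auto
    let ?e = "inverse (real (Suc n))"
    have "x \<in> mtopology closure_of D" using D xS by simp
    then have "\<forall>r>0. \<exists>y\<in>D. y \<in> mball x r"
      by (simp add: metric_closure_of)
    moreover have "?e > 0" by simp
    ultimately obtain y where y: "y \<in> D" "y \<in> mball x ?e" by meson
    have "mball y ?e \<subseteq> mball x r"
    proof
      fix z assume "z \<in> mball y ?e"
      then show "z \<in> mball x r"
        using y n triangle[of x y z] by (auto simp: in_mball)
    qed
    moreover have "x \<in> mball y ?e"
      using y by (auto simp: in_mball commute)
    ultimately show ?thesis
      using r y(1) unfolding B_def f_def by blast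
  qed
  then have "countably_based_hausdorff \<tau> (from_nat_into B)"
    using B oB by unfold_locales
      (auto simp: from_nat_into metrizable_imp_Hausdorff_space[OF met],
       metis from_nat_into_surj)
  then show thesis by (rule that)
qed

section \<open>Uniqueness of the law of a random closed set\<close>

text \<open>Missing \<open>U\<close> and missing \<open>V\<close> together is missing \<open>U \<union> V\<close>, so the families of closed sets missing an open
set form an intersection-stable generator.\<close>
lemma effros_prob_eqI:
  assumes R: "sets R = sets (effros \<tau>)" "prob_space R"
    and R': "sets R' = sets (effros \<tau>)" "prob_space R'"
    and eq: "\<And>U. openin \<tau> U \<Longrightarrow> emeasure R {F. closedin \<tau> F \<and> F \<inter> U = {}} =
                                emeasure R' {F. closedin \<tau> F \<and> F \<inter> U = {}}"
  shows "R = R'"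
proof -
  interpret prob_space R by fact
  let ?\<Omega> = "{F. closedin \<tau> F}"
  define E where "E = (\<lambda>U. {F. closedin \<tau> F \<and> F \<inter> U = {}}) ` {U. openin \<tau> U}"
  have EP: "E \<subseteq> Pow ?\<Omega>" by (auto simp: E_def)
  have "E \<subseteq> sets (effros \<tau>)"
    using measurable_sets[OF pred_miss, of \<tau> _ "{True}"] unfolding E_def
    by (auto simp: Int_def vimage_def conj_commute)
  then have "sigma_sets ?\<Omega> E \<subseteq> sets (effros \<tau>)"
    using sets.sigma_sets_subset[of E "effros \<tau>"] by simp
  moreover have "sets (effros \<tau>) \<subseteq> sigma_sets ?\<Omega> E"
    unfolding sets_effros
  proof (rule sigma_sets_mono, safe)
    fix U assume U: "openin \<tau> U"
    have "?\<Omega> - {F. closedin \<tau> F \<and> F \<inter> U = {}} \<in> sigma_sets ?\<Omega> E"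
      using U by (intro sigma_sets.Compl sigma_sets.Basic) (auto simp: E_def)
    also have "?\<Omega> - {F. closedin \<tau> F \<and> F \<inter> U = {}} = {F. closedin \<tau> F \<and> F \<inter> U \<noteq> {}}"
      by auto
    finally show "{F. closedin \<tau> F \<and> F \<inter> U \<noteq> {}} \<in> sigma_sets ?\<Omega> E" .
  qed
  ultimately have gen: "sets (effros \<tau>) = sigma_sets ?\<Omega> E" by simp
  have "Int_stable E"
  proof (rule Int_stableI)
    fix a c assume "a \<in> E" "c \<in> E"
    then obtain U V where "openin \<tau> U" "openin \<tau> V" "a = {F. closedin \<tau> F \<and> F \<inter> U = {}}"
      "c = {F. closedin \<tau> F \<and> F \<inter> V = {}}" by (auto simp: E_def)
    moreover from this have "a \<inter> c = {F. closedin \<tau> F \<and> F \<inter> (U \<union> V) = {}}" by auto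
    ultimately show "a \<inter> c \<in> E"
      using openin_Un[of \<tau> U V] unfolding E_def by blast
  qed
  then show ?thesis
  proof (rule measure_eqI_generator_eq[OF _ EP, where A="\<lambda>_. ?\<Omega>"])
    show "emeasure R X = emeasure R' X" if "X \<in> E" for X
      using that eq by (auto simp: E_def)
    have "?\<Omega> = {F. closedin \<tau> F \<and> F \<inter> {} = {}}" by simp
    then show "range (\<lambda>i::nat. ?\<Omega>) \<subseteq> E"
      unfolding E_def by (auto intro!: image_eqI[of _ _ "{}"])
  qed (use R R' gen in \<open>auto simp: emeasure_eq_measure\<close>)
qed

lemma poisson_process_AE_isolated_points_dense:
  assumes R: "sets R = sets (effros \<tau>)" and P: "poisson_point_process R N (point_count \<tau>)"
  shows "AE F in R. isolated_points_dense \<tau> F"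
proof -
  have m: "point_count \<tau> {} \<in> measurable R (count_space UNIV)"
    and d: "distr R (count_space UNIV) (point_count \<tau> {}) = measure_pmf (Poiss (emeasure N {}))"
    using P by (auto simp: poisson_point_process_def)
  have "AE n in measure_pmf (Poiss (emeasure N {})). n = 0"
    by (simp add: Poiss_def AE_measure_pmf_iff)
  then have "AE F in R. point_count \<tau> {} F = 0"
    unfolding d[symmetric] using m by (simp add: AE_distr_iff)
  then show ?thesis
    by eventually_elim (auto simp: point_count_def split: if_splits)
qed

lemma poisson_process_miss:
  assumes R: "sets R = sets (effros \<tau>)" and P: "poisson_point_process R N (point_count \<tau>)"
    and U: "openin \<tau> U" "U \<in> sets N"
  shows "emeasure R {F. closedin \<tau> F \<and> F \<inter> U = {}} =
         emeasure (measure_pmf (Poiss (emeasure N U))) {0}"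
proof -
  have m: "point_count \<tau> U \<in> measurable R (count_space UNIV)"
    and d: "distr R (count_space UNIV) (point_count \<tau> U) = measure_pmf (Poiss (emeasure N U))"
    using P U by (auto simp: poisson_point_process_def)
  have sp: "space R = {F. closedin \<tau> F}"
    using sets_eq_imp_space_eq[OF R] by simp
  have "{F. closedin \<tau> F \<and> F \<inter> U = {}} \<in> sets R"
    using measurable_sets[OF pred_miss[OF U(1)], of "{True}"] R
    by (auto simp: Int_def vimage_def conj_commute)
  moreover have "point_count \<tau> U -` {0} \<inter> space R \<in> sets R"
    using m by (rule measurable_sets) simp
  moreover have "AE F in R. F \<in> {F. closedin \<tau> F \<and> F \<inter> U = {}} \<longleftrightarrow> 
       F \<in> point_count \<tau> U -` {0} \<inter> space R"
    using poisson_process_AE_isolated_points_dense[OF R P]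
    by eventually_elim (auto simp: sp point_count_eq_0_iff[OF _ U(1)])
  ultimately have "emeasure R {F. closedin \<tau> F \<and> F \<inter> U = {}} =
      emeasure R (point_count \<tau> U -` {0} \<inter> space R)"
    by (intro emeasure_eq_AE) auto
  also have "\<dots> = emeasure (distr R (count_space UNIV) (point_count \<tau> U)) {0}"
    using m by (simp add: emeasure_distr)
  finally show ?thesis by (simp add: d)
qed

lemma poisson_process_unique:
  assumes R: "random_closed_set \<tau> R" "poisson_point_process R N (point_count \<tau>)"
    and R': "random_closed_set \<tau> R'" "poisson_point_process R' N (point_count \<tau>)"
    and open_N: "\<And>U. openin \<tau> U \<Longrightarrow> U \<in> sets N"
  shows "R = R'"
proof (rule effros_prob_eqI)
  show "sets R = sets (effros \<tau>)" "prob_space R" "sets R' = sets (effros \<tau>)" "prob_space R'"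
    using R(1) R'(1) by (auto simp: random_closed_set_def)
  fix U assume U: "openin \<tau> U"
  show "emeasure R {F. closedin \<tau> F \<and> F \<inter> U = {}} = emeasure R' {F. closedin \<tau> F \<and> F \<inter> U = {}}"
    using R R' U open_N[OF U] by (simp add: poisson_process_miss random_closed_set_def)
qed

section \<open>Probability generating functions on the extended naturals\<close>

definition enat_power :: "real \<Rightarrow> enat \<Rightarrow> real" where
  "enat_power s n = (case n of enat k \<Rightarrow> s ^ k | \<infinity> \<Rightarrow> 0)"

definition pgf :: "enat measure \<Rightarrow> real \<Rightarrow> ennreal" where
  "pgf Q s = (\<integral>\<^sup>+n. ennreal (enat_power s n) \<partial>Q)"

lemma enat_power_simps [simp]:
  "enat_power s (enat k) = s ^ k" "enat_power s \<infinity> = 0" "enat_power s 0 = 1"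
  by (simp_all add: enat_power_def zero_enat_def)

text \<open>The mass at \<open>\<infinity>\<close> does not contribute, since \<^term>\<open>enat_power s \<infinity> = 0\<close>; it is recovered in
\<open>pgf_inject\<close> as the missing mass.\<close>
lemma pgf_sums:
  assumes Q: "prob_space Q" "sets Q = UNIV" and s: "0 \<le> s" "s < 1"
  shows "pgf Q s = ennreal (\<Sum>k. measure Q {enat k} * s ^ k)"
    and "summable (\<lambda>k. measure Q {enat k} * s ^ k)"
proof -
  interpret prob_space Q by fact
  show sm: "summable (\<lambda>k. measure Q {enat k} * s ^ k)"
    by (rule summable_comparison_test'[OF summable_geometric[of s], of 0])
       (use s in \<open>auto simp: abs_mult intro!: mult_left_le_one_le\<close>)
  have "ennreal (enat_power s n) = (\<Sum>k. ennreal (s ^ k) * indicator {enat k} n)" for n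
  proof (cases n)
    case (enat k)
    have "disjoint_family (\<lambda>k. {enat k})" by (auto simp: disjoint_family_on_def)
    from suminf_cmult_indicator[OF this, of n k] enat show ?thesis by simp
  qed auto
  then have "pgf Q s = (\<integral>\<^sup>+n. (\<Sum>k. ennreal (s ^ k) * indicator {enat k} n) \<partial>Q)"
    by (simp add: pgf_def)
  also have "\<dots> = (\<Sum>k. \<integral>\<^sup>+n. ennreal (s ^ k) * indicator {enat k} n \<partial>Q)"
    by (rule nn_integral_suminf) (auto simp: measurable_def Q)
  also have "\<dots> = (\<Sum>k. ennreal (measure Q {enat k} * s ^ k))"
    using s by (simp add: nn_integral_cmult_indicator Q emeasure_eq_measure ennreal_mult' mult.commute)
  also have "\<dots> = ennreal (\<Sum>k. measure Q {enat k} * s ^ k)"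
    using s by (intro suminf_ennreal2 sm) auto
  finally show "pgf Q s = ennreal (\<Sum>k. measure Q {enat k} * s ^ k)" .
qed

text \<open>Otherwise 0 would be an isolated zero of the power series.\<close>
lemma power_series_eq_0:
  fixes a :: "nat \<Rightarrow> real"
  assumes bounded: "\<And>k. \<bar>a k\<bar> \<le> 1"
    and zero: "\<And>s. 0 \<le> s \<Longrightarrow> s < 1 \<Longrightarrow> (\<lambda>k. a k * s ^ k) sums 0"
  shows "a k = 0"
proof (rule ccontr)
  assume ak: "a k \<noteq> 0"
  define f where "f x = (\<Sum>k. a k * x ^ k)" for x
  have f0: "f s = 0" if "0 \<le> s" "s < 1" for s
    using zero[OF that] by (simp add: f_def sums_iff)
  have "a 0 = 0"
    using zero[of 0] sums_unique2[OF powser_sums_zero[of a]] by fastforce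
  with ak have "k > 0" by (cases k) auto
  have "(\<lambda>k. a k * (x - 0) ^ k) sums f x" if "norm (x - 0) < 1" for x
  proof -
    have "summable (\<lambda>k. a k * x ^ k)"
      by (rule summable_comparison_test'[OF summable_geometric[of "\<bar>x\<bar>"], of 0])
         (use that bounded in \<open>auto simp: abs_mult power_abs intro!: mult_left_le_one_le\<close>)
    then show ?thesis by (simp add: f_def summable_sums)
  qed
  from powser_0_nonzero[of 1 0 a f, OF _ this _ ak \<open>k > 0\<close>] f0[of 0]
  obtain r where r: "0 < r" "\<And>z. z \<in> cball 0 r - {0} \<Longrightarrow> f z \<noteq> 0" by auto
  define z where "z = min r (1/2)"
  have "z \<in> cball 0 r - {0}" "0 \<le> z" "z < 1" using r(1) by (auto simp: z_def)
  with r(2) f0 show False by blast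
qed

lemma pgf_inject:
  assumes Q: "prob_space Q" "sets Q = UNIV" and Q': "prob_space Q'" "sets Q' = UNIV"
    and eq: "\<And>s. 0 \<le> s \<Longrightarrow> s < 1 \<Longrightarrow> pgf Q s = pgf Q' s"
  shows "Q = Q'"
proof -
  interpret Q: prob_space Q by fact
  interpret Q': prob_space Q' by fact
  have fin: "measure Q {enat k} - measure Q' {enat k} = 0" for k
  proof (rule power_series_eq_0[where a="\<lambda>k. measure Q {enat k} - measure Q' {enat k}"])
    fix k
    show "\<bar>measure Q {enat k} - measure Q' {enat k}\<bar> \<le> 1"
      using Q.prob_le_1[of "{enat k}"] Q'.prob_le_1[of "{enat k}"]
        measure_nonneg[of Q "{enat k}"] measure_nonneg[of Q' "{enat k}"] by linarith
  next
    fix s :: real assume s: "0 \<le> s" "s < 1"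
    note q = pgf_sums[OF Q s] and q' = pgf_sums[OF Q' s]
    have "(\<Sum>k. measure Q {enat k} * s ^ k) = (\<Sum>k. measure Q' {enat k} * s ^ k)"
      using eq[OF s] q q' s by (simp add: suminf_nonneg)
    then show "(\<lambda>k. (measure Q {enat k} - measure Q' {enat k}) * s ^ k) sums 0"
      using sums_diff[OF summable_sums[OF q(2)] summable_sums[OF q'(2)]]
      by (simp add: algebra_simps)
  qed
  have inf: "measure Q {\<infinity>} = measure Q' {\<infinity>}"
  proof -
    have *: "(\<lambda>k. measure P {enat k}) sums (1 - measure P {\<infinity>})"
      if "prob_space P" "sets P = UNIV" for P
    proof -
      interpret P: prob_space P by fact
      have "(\<lambda>k. measure P {enat k}) sums measure P (\<Union>k. {enat k})"
        by (rule P.finite_measure_UNION) (auto simp: that disjoint_family_on_def)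
      also have "(\<Union>k. {enat k}) = space P - {\<infinity>}"
        using sets_eq_imp_space_eq[of P "count_space UNIV"] that
        by (auto intro: not_infinity_eq[THEN iffD1, elim_format])
      also have "measure P (space P - {\<infinity>}) = 1 - measure P {\<infinity>}"
        by (rule P.prob_compl) (simp add: that)
      finally show ?thesis .
    qed
    show ?thesis
      using sums_unique2[OF *[OF Q]] *[OF Q'] fin by fastforce
  qed
  have "measure Q {n} = measure Q' {n}" for n
    using fin inf by (cases n) auto
  then show ?thesis
    by (intro measure_eqI_countable[of Q UNIV])
       (auto simp: Q Q' Q.emeasure_eq_measure Q'.emeasure_eq_measure)
qed

text \<open>The generating function of the Poisson distribution. With \<open>q\<close> the generating function of a single
0-1 trial, it is also that of a Poisson number of such trials.\<close>
lemma nn_integral_poisson_power: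
  assumes "0 < r" "0 \<le> q"
  shows "(\<integral>\<^sup>+n. ennreal (q ^ n) \<partial>measure_pmf (poisson_pmf r)) = ennreal (exp (- r * (1 - q)))"
proof -
  have "(\<lambda>n. exp (- r) * ((r * q) ^ n /\<^sub>R fact n)) sums (exp (- r) * exp (r * q))"
    by (intro sums_mult exp_converges)
  also have "exp (- r) * exp (r * q) = exp (- r * (1 - q))"
    by (simp add: exp_add[symmetric] algebra_simps)
  finally have "(\<lambda>n. pmf (poisson_pmf r) n * q ^ n) sums exp (- r * (1 - q))"
    using assms by (simp add: field_simps)
  then have "(\<Sum>n. ennreal (pmf (poisson_pmf r) n * q ^ n)) = ennreal (exp (- r * (1 - q)))"
    using assms by (intro suminf_ennreal_eq) auto
  then show ?thesis
    using assms by (simp add: nn_integral_measure_pmf nn_integral_count_space_nat ennreal_mult[symmetric]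
        del: pmf_poisson)
qed

lemma pgf_Poiss:
  assumes s: "0 \<le> s" "s < 1"
  shows "pgf (measure_pmf (Poiss \<alpha>)) s = 
           (if \<alpha> = \<infinity> then 0 else ennreal (exp (- (1 - s) * enn2real \<alpha>)))"
proof -
  consider "\<alpha> = 0" | "\<alpha> = \<infinity>" | "\<alpha> \<noteq> 0" "\<alpha> \<noteq> \<infinity>" by blast
  then show ?thesis
  proof cases
    case 3
    then have "0 < enn2real \<alpha>"
      by (simp add: enn2real_positive_iff less_top zero_less_iff_neq_zero)
    with 3 s show ?thesis
      by (simp add: pgf_def Poiss_def nn_integral_poisson_power[simplified])
         (simp add: algebra_simps)
  qed (auto simp: pgf_def Poiss_def nn_integral_return_pmf)
qed

section \<open>Poisson samples of a finite diffuse measure\<close>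

text \<open>Counting the distinct values in \<open>A\<close> by their first occurrence. This makes the count of a sample set,
not merely of a sequence of points, a measurable function of the sequence.\<close>
lemma card_image_lessThan_Suc_Int:
  "card (\<xi> ` {..<Suc n} \<inter> A) =
     card (\<xi> ` {..<n} \<inter> A) + (if \<xi> n \<in> A \<and> (\<forall>j<n. \<xi> j \<noteq> \<xi> n) then 1 else 0)"
proof -
  have "\<xi> ` {..<Suc n} \<inter> A =
      (if \<xi> n \<in> A then insert (\<xi> n) (\<xi> ` {..<n} \<inter> A) else \<xi> ` {..<n} \<inter> A)"
    by (auto simp: lessThan_Suc)
  moreover have "\<xi> n \<in> \<xi> ` {..<n} \<longleftrightarrow> \<not> (\<forall>j<n. \<xi> j \<noteq> \<xi> n)"
    by (metis imageE imageI lessThan_iff)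
  ultimately show ?thesis
    by (simp add: card_insert_if)
qed

lemma indep_vars_PiM_component:
  assumes "\<And>i. prob_space (\<Omega> i)"
  shows "prob_space.indep_vars (PiM UNIV \<Omega>) \<Omega> (\<lambda>i \<omega>. \<omega> i) (UNIV :: 'i set)"
proof -
  interpret prob_space "PiM UNIV \<Omega>"
    using assms by (intro prob_space_PiM)
  show ?thesis
    using assms by (subst indep_vars_iff_distr_eq_PiM')
      (auto simp: restrict_def[abs_def] distr_PiM_component)
qed

lemma nn_integral_PiM_prod:
  fixes f :: "'i \<Rightarrow> 'b \<Rightarrow> ennreal"
  assumes "\<And>i. prob_space (\<Omega> i)" "\<And>i. f i \<in> borel_measurable (\<Omega> i)" "finite J"
  shows "(\<integral>\<^sup>+\<omega>. (\<Prod>i\<in>J. f i (\<omega> i)) \<partial>PiM UNIV \<Omega>) = (\<Prod>i\<in>J. \<integral>\<^sup>+x. f i x \<partial>\<Omega> i)"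
proof -
  interpret prob_space "PiM UNIV \<Omega>"
    using assms by (intro prob_space_PiM)
  have "indep_vars (\<lambda>_. borel) (\<lambda>i \<omega>. f i (\<omega> i)) UNIV"
    by (rule indep_vars_compose2[OF indep_vars_PiM_component]) (use assms in auto)
  then have "(\<integral>\<^sup>+\<omega>. (\<Prod>i\<in>J. f i (\<omega> i)) \<partial>PiM UNIV \<Omega>) = (\<Prod>i\<in>J. \<integral>\<^sup>+\<omega>. f i (\<omega> i) \<partial>PiM UNIV \<Omega>)"
    using assms(3) by (intro indep_vars_nn_integral indep_vars_subset[where J=J and I=UNIV]) auto
  moreover have "(\<integral>\<^sup>+\<omega>. f i (\<omega> i) \<partial>PiM UNIV \<Omega>) = (\<integral>\<^sup>+x. f i x \<partial>\<Omega> i)" for i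
    using assms nn_integral_distr[of "\<lambda>\<omega>. \<omega> i" "PiM UNIV \<Omega>" "\<Omega> i" "f i"]
    by (simp add: distr_PiM_component)
  ultimately show ?thesis by simp
qed

lemma singleton_in_sets:
  assumes "Measurable.pred (\<nu> \<Otimes>\<^sub>M \<nu>) (\<lambda>p. fst p = snd p)" and x: "x \<in> space \<nu>"
  shows "{x} \<in> sets \<nu>"
proof -
  note [measurable] = assms(1)
  have "{y \<in> space \<nu>. fst (x, y) = snd (x, y)} \<in> sets \<nu>"
    using x by measurable
  also have "{y \<in> space \<nu>. fst (x, y) = snd (x, y)} = {x}"
    using x by auto
  finally show ?thesis .
qed
text \<open>Any two coordinates have joint law \<open>\<rho> \<Otimes> \<rho>\<close>, which gives the diagonal mass 0 by Fubini, since \<open>\<rho>\<close> has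
no point masses.\<close>
lemma AE_PiM_distinct:
  assumes \<rho>: "prob_space \<rho>" and diffuse: "\<And>x. x \<in> space \<rho> \<Longrightarrow> emeasure \<rho> {x} = 0"
    and diag: "Measurable.pred (\<rho> \<Otimes>\<^sub>M \<rho>) (\<lambda>p. fst p = snd p)"
  shows "AE \<xi> in PiM UNIV (\<lambda>_::nat. \<rho>). inj \<xi>"
proof -
  interpret \<rho>: prob_space \<rho> by fact
  interpret product_prob_space "\<lambda>_::nat. \<rho>" UNIV ..
  interpret pair_sigma_finite \<rho> \<rho> ..
  note [measurable] = diag
  note sing = singleton_in_sets[OF diag]
  have "AE x in \<rho>. AE y in \<rho>. fst (x, y) \<noteq> snd (x, y)"
  proof (rule AE_I2)
    fix x assume x: "x \<in> space \<rho>"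
    have "AE y in \<rho>. y \<notin> {x}"
      using diffuse[OF x] sing[OF x] by (intro AE_not_in) (auto simp: null_sets_def)
    then show "AE y in \<rho>. fst (x, y) \<noteq> snd (x, y)" by eventually_elim auto
  qed
  then have AE: "AE p in \<rho> \<Otimes>\<^sub>M \<rho>. fst p \<noteq> snd p"
    by (intro AE_pair_measure) measurable
  have "AE \<xi> in PiM UNIV (\<lambda>_::nat. \<rho>). \<xi> i \<noteq> \<xi> j" if "i \<noteq> j" for i j
  proof -
    have eq: "\<rho> \<Otimes>\<^sub>M \<rho> = distr (PiM UNIV (\<lambda>_. \<rho>)) (\<rho> \<Otimes>\<^sub>M \<rho>) (\<lambda>\<xi>. (\<xi> i, \<xi> j))"
    proof (rule pair_measure_eqI)
      fix A B assume AB: "A \<in> sets \<rho>" "B \<in> sets \<rho>"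
      have "emeasure (distr (PiM UNIV (\<lambda>_. \<rho>)) (\<rho> \<Otimes>\<^sub>M \<rho>) (\<lambda>\<xi>. (\<xi> i, \<xi> j))) (A \<times> B) =
          emeasure (PiM UNIV (\<lambda>_. \<rho>)) {\<xi> \<in> space (PiM UNIV (\<lambda>_. \<rho>)).
            \<forall>k\<in>{i, j}. \<xi> k \<in> (if k = i then A else B)}"
        using AB that by (subst emeasure_distr) (auto intro!: arg_cong2[where f=emeasure])
      also have "\<dots> = emeasure \<rho> A * emeasure \<rho> B"
        using AB that by (subst emeasure_PiM_Collect) auto
      finally show "emeasure \<rho> A * emeasure \<rho> B =
        emeasure (distr (PiM UNIV (\<lambda>_. \<rho>)) (\<rho> \<Otimes>\<^sub>M \<rho>) (\<lambda>\<xi>. (\<xi> i, \<xi> j))) (A \<times> B)" ..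
    qed (auto intro: \<rho>.sigma_finite_measure_axioms)
    have "AE p in distr (PiM UNIV (\<lambda>_. \<rho>)) (\<rho> \<Otimes>\<^sub>M \<rho>) (\<lambda>\<xi>. (\<xi> i, \<xi> j)). fst p \<noteq> snd p"
      by (subst eq[symmetric]) (rule AE)
    then show ?thesis
      by (subst (asm) AE_distr_iff) auto
  qed
  then have "AE \<xi> in PiM UNIV (\<lambda>_::nat. \<rho>). \<forall>i j. i \<noteq> j \<longrightarrow> \<xi> i \<noteq> \<xi> j"
    by (simp add: AE_all_countable)
  then show ?thesis
    by eventually_elim (auto simp: inj_def)
qed

lemma measurable_card_sample:
  assumes diag: "Measurable.pred (\<rho> \<Otimes>\<^sub>M \<rho>) (\<lambda>p. fst p = snd p)" and A: "A \<in> sets \<rho>"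
  shows "(\<lambda>\<xi>. card (\<xi> ` {..<n} \<inter> A)) \<in> measurable (PiM UNIV (\<lambda>_::nat. \<rho>)) (count_space UNIV)"
proof (induction n)
  case (Suc n)
  note [measurable] = A Suc
  have [measurable]: "Measurable.pred (PiM UNIV (\<lambda>_::nat. \<rho>)) (\<lambda>\<xi>. \<xi> i = \<xi> j)" for i j
  proof -
    have "(\<lambda>\<xi>. (\<xi> i, \<xi> j)) \<in> measurable (PiM UNIV (\<lambda>_::nat. \<rho>)) (\<rho> \<Otimes>\<^sub>M \<rho>)"
      by measurable
    from measurable_compose[OF this diag] show ?thesis by simp
  qed
  have [measurable]: "(\<lambda>\<xi>. i + (if \<xi> n \<in> A \<and> (\<forall>j<n. \<xi> j \<noteq> \<xi> n) then 1 else 0 :: nat))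
    \<in> measurable (PiM UNIV (\<lambda>_::nat. \<rho>)) (count_space UNIV)" for i
    unfolding if_distrib[of "\<lambda>k. i + k"] by measurable
  show ?case
    unfolding card_image_lessThan_Suc_Int
    by (rule measurable_compose_countable[OF _ Suc]) measurable
qed simp

text \<open>Thinning: given that the sample has \<open>n\<close> points, these are almost surely distinct and each of them lies
in \<open>A\<close> with probability \<open>\<rho> A\<close>, so \<open>s\<close> to the number of points in \<open>A\<close> has mean
\<open>(1 - \<rho> A * (1 - s)) ^ n\<close>. Averaging over a Poisson number \<open>n\<close> with mean \<open>r\<close> gives the generating
function of the Poisson distribution with mean \<open>r * \<rho> A\<close>.\<close>
lemma poisson_sample_prob:
  fixes \<rho> :: "'a measure"
  defines "P \<equiv> \<lambda>(n::nat, \<xi>::nat \<Rightarrow> 'a). \<xi> ` {..<n}"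
  assumes \<rho>: "prob_space \<rho>" and diffuse: "\<And>x. x \<in> space \<rho> \<Longrightarrow> emeasure \<rho> {x} = 0"
    and diag: "Measurable.pred (\<rho> \<Otimes>\<^sub>M \<rho>) (\<lambda>p. fst p = snd p)"
    and r: "0 < r"
    and A: "A \<in> sets \<rho>"
  defines "\<Omega> \<equiv> measure_pmf (poisson_pmf r) \<Otimes>\<^sub>M PiM UNIV (\<lambda>_::nat. \<rho>)"
  shows "(\<lambda>\<omega>. card (P \<omega> \<inter> A)) \<in> measurable \<Omega> (count_space UNIV)" (is ?meas)
    and "0 \<le> s \<Longrightarrow> s \<le> 1 \<Longrightarrow> 
      (\<integral>\<^sup>+\<omega>. ennreal (s ^ card (P \<omega> \<inter> A)) \<partial>\<Omega>) = ennreal (exp (- (1 - s) * (r * measure \<rho> A)))"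
proof -
  interpret \<rho>: prob_space \<rho> by fact
  interpret S: prob_space "PiM UNIV (\<lambda>_::nat. \<rho>)"
    by (intro prob_space_PiM \<rho>)
  have sets_\<Omega>: "sets \<Omega> = sets (count_space UNIV \<Otimes>\<^sub>M PiM UNIV (\<lambda>_::nat. \<rho>))"
    unfolding \<Omega>_def by (intro sets_pair_measure_cong) auto
  have "(\<lambda>\<omega>. card (P \<omega> \<inter> A)) \<in>
      measurable (count_space UNIV \<Otimes>\<^sub>M PiM UNIV (\<lambda>_::nat. \<rho>)) (count_space UNIV)"
    using measurable_card_sample[OF diag A]
    by (intro measurable_pair_measure_countable1) (auto simp: P_def)
  then show meas[measurable]: ?meas
    by (subst measurable_cong_sets[OF sets_\<Omega> refl])
  assume s: "0 \<le> s" "s \<le> 1"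
  define g where "g x = (if x \<in> A then s else 1)" for x
  have [measurable]: "(\<lambda>x. ennreal (g x)) \<in> borel_measurable \<rho>"
    using A unfolding g_def by measurable
  have g: "(\<integral>\<^sup>+x. ennreal (g x) \<partial>\<rho>) = ennreal (1 - measure \<rho> A * (1 - s))" 
  proof -
    have "(\<integral>\<^sup>+x. ennreal (g x) \<partial>\<rho>) = (\<integral>\<^sup>+x. ennreal s * indicator A x + indicator (space \<rho> - A) x \<partial>\<rho>)"
      by (intro nn_integral_cong) (auto simp: g_def indicator_def)
    also have "\<dots> = ennreal s * emeasure \<rho> A + emeasure \<rho> (space \<rho> - A)"
      using A by (subst nn_integral_add) (auto simp: nn_integral_cmult_indicator)
    also have "\<dots> = ennreal (s * measure \<rho> A + (1 - measure \<rho> A))"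
      using A s by (simp add: \<rho>.emeasure_eq_measure \<rho>.prob_compl ennreal_mult)
    also have "s * measure \<rho> A + (1 - measure \<rho> A) = 1 - measure \<rho> A * (1 - s)"
      by (simp add: algebra_simps)
    finally show ?thesis .
  qed
  have q: "0 \<le> 1 - measure \<rho> A * (1 - s)"
    using s \<rho>.prob_le_1[of A] mult_le_one[of "measure \<rho> A" "1 - s"] by simp
  have inj: "AE \<xi> in PiM UNIV (\<lambda>_::nat. \<rho>). inj \<xi>"
    by (rule AE_PiM_distinct) (use \<rho> diffuse diag in auto)
  have inner: "(\<integral>\<^sup>+\<xi>. ennreal (s ^ card (\<xi> ` {..<n} \<inter> A)) \<partial>PiM UNIV (\<lambda>_::nat. \<rho>)) =
      ennreal ((1 - measure \<rho> A * (1 - s)) ^ n)" for n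
  proof -
    have "(\<integral>\<^sup>+\<xi>. ennreal (s ^ card (\<xi> ` {..<n} \<inter> A)) \<partial>PiM UNIV (\<lambda>_::nat. \<rho>)) =
        (\<integral>\<^sup>+\<xi>. (\<Prod>i<n. ennreal (g (\<xi> i))) \<partial>PiM UNIV (\<lambda>_::nat. \<rho>))"
    proof (rule nn_integral_cong_AE)
      show "AE \<xi> in PiM UNIV (\<lambda>_::nat. \<rho>).
          ennreal (s ^ card (\<xi> ` {..<n} \<inter> A)) = (\<Prod>i<n. ennreal (g (\<xi> i)))"
        using inj
      proof eventually_elim
        case (elim \<xi>)
        have "s ^ card (\<xi> ` {..<n} \<inter> A) = (\<Prod>i<n. g (\<xi> i))"
        proof (induction n)
          case (Suc n)
          have "\<forall>j<n. \<xi> j \<noteq> \<xi> n" using elim by (auto simp: inj_def)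
          with Suc show ?case
            by (auto simp: card_image_lessThan_Suc_Int g_def)
        qed simp
        then show ?case
          using s by (simp add: prod_ennreal g_def)
      qed
    qed
    also have "\<dots> = (\<Prod>i<n. \<integral>\<^sup>+x. ennreal (g x) \<partial>\<rho>)"
      by (intro nn_integral_PiM_prod) (auto intro: \<rho>)
    also have "\<dots> = ennreal ((1 - measure \<rho> A * (1 - s)) ^ n)"
      using q by (simp add: g ennreal_power)
    finally show ?thesis .
  qed
  have "(\<integral>\<^sup>+\<omega>. ennreal (s ^ card (P \<omega> \<inter> A)) \<partial>\<Omega>) =
      (\<integral>\<^sup>+n. \<integral>\<^sup>+\<xi>. ennreal (s ^ card (\<xi> ` {..<n} \<inter> A)) \<partial>PiM UNIV (\<lambda>_::nat. \<rho>) \<partial>poisson_pmf r)"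
    using meas unfolding \<Omega>_def
    by (subst S.nn_integral_fst[symmetric]) (auto simp: P_def)
  also have "\<dots> = ennreal (exp (- r * (1 - (1 - measure \<rho> A * (1 - s)))))"
    unfolding inner by (rule nn_integral_poisson_power[OF r q])
  finally show "(\<integral>\<^sup>+\<omega>. ennreal (s ^ card (P \<omega> \<inter> A)) \<partial>\<Omega>) =
      ennreal (exp (- (1 - s) * (r * measure \<rho> A)))"
    by (simp add: algebra_simps)
qed

text \<open>A nonzero finite measure is sampled by normalising it and taking its total mass as the mean number
of points. The zero measure cannot be normalised, and its space may be empty; there the sample is
always empty.\<close>
lemma poisson_sample:
  fixes \<nu> :: "'a measure"
  assumes \<nu>: "finite_measure \<nu>" and diffuse: "\<And>x. x \<in> space \<nu> \<Longrightarrow> emeasure \<nu> {x} = 0"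
    and diag: "Measurable.pred (\<nu> \<Otimes>\<^sub>M \<nu>) (\<lambda>p. fst p = snd p)"
  obtains \<Omega> :: "(nat \<times> (nat \<Rightarrow> 'a)) measure" and P :: "nat \<times> (nat \<Rightarrow> 'a) \<Rightarrow> 'a set"
  where "prob_space \<Omega>" "\<And>\<omega>. \<omega> \<in> space \<Omega> \<Longrightarrow> finite (P \<omega>) \<and> P \<omega> \<subseteq> space \<nu>"
    "\<And>A. A \<in> sets \<nu> \<Longrightarrow> (\<lambda>\<omega>. card (P \<omega> \<inter> A)) \<in> measurable \<Omega> (count_space UNIV)"
    "\<And>A s. A \<in> sets \<nu> \<Longrightarrow> 0 \<le> s \<Longrightarrow> s \<le> 1 \<Longrightarrow>
       (\<integral>\<^sup>+\<omega>. ennreal (s ^ card (P \<omega> \<inter> A)) \<partial>\<Omega>) = ennreal (exp (- (1 - s) * measure \<nu> A))"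
proof (cases "emeasure \<nu> (space \<nu>) = 0")
  case True
  let ?\<Omega> = "return (count_space UNIV) (0, undefined) :: (nat \<times> (nat \<Rightarrow> 'a)) measure"
  have "prob_space ?\<Omega>" by (rule prob_space_return) simp
  moreover have "measure \<nu> A = 0" for A
    using emeasure_space[of \<nu> A] True by (simp add: measure_def)
  ultimately show ?thesis
    by (intro that[of ?\<Omega> "\<lambda>_. {}"]) (auto simp: prob_space.emeasure_space_1)
next
  case False
  interpret \<nu>: finite_measure \<nu> by fact
  let ?r = "measure \<nu> (space \<nu>)"
  define \<rho> where "\<rho> = uniform_measure \<nu> (space \<nu>)"
  let ?\<Omega> = "measure_pmf (poisson_pmf ?r) \<Otimes>\<^sub>M PiM UNIV (\<lambda>_::nat. \<rho>)"
  let ?P = "\<lambda>(n::nat, \<xi>::nat \<Rightarrow> 'a). \<xi> ` {..<n}"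
  have r: "?r > 0" using False by (simp add: \<nu>.emeasure_eq_measure zero_less_measure_iff)
  have \<rho>: "prob_space \<rho>"
    unfolding \<rho>_def using False by (intro prob_space_uniform_measure) auto
  have [simp]: "sets \<rho> = sets \<nu>" "space \<rho> = space \<nu>" by (auto simp: \<rho>_def)
  have "sets (\<rho> \<Otimes>\<^sub>M \<rho>) = sets (\<nu> \<Otimes>\<^sub>M \<nu>)"
    by (intro sets_pair_measure_cong) auto
  then have diag': "Measurable.pred (\<rho> \<Otimes>\<^sub>M \<rho>) (\<lambda>p. fst p = snd p)"
    using diag measurable_cong_sets by blast
  note sing = singleton_in_sets[OF diag]
  have m: "emeasure \<rho> A = emeasure \<nu> A / emeasure \<nu> (space \<nu>)" if "A \<in> sets \<nu>" for A
    using that sets.sets_into_space[OF that] by (simp add: \<rho>_def Int_absorb1)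
  have diffuse': "emeasure \<rho> {x} = 0" if "x \<in> space \<rho>" for x
    using that by (simp add: m sing diffuse)
  have m': "?r * measure \<rho> A = measure \<nu> A" if "A \<in> sets \<nu>" for A
    using r by (simp add: measure_def[of \<rho>] m that \<nu>.emeasure_eq_measure divide_ennreal)
  have 0: "prob_space ?\<Omega>"
    by (intro prob_space_pair prob_space_PiM \<rho> prob_space_measure_pmf)
  have 1: "finite (?P \<omega>) \<and> ?P \<omega> \<subseteq> space \<nu>" if "\<omega> \<in> space ?\<Omega>" for \<omega>
    using that by (auto simp: space_pair_measure space_PiM PiE_iff)
  note 2 = poisson_sample_prob[OF \<rho> diffuse' diag' r]
  show ?thesis
    by (rule that[OF 0 1]) (use 2 m' in auto)
qed

section \<open>Gluing the cells of a partition\<close>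

lemma pred_diagonal:
  fixes B :: "nat \<Rightarrow> 'a set"
  assumes meas: "\<And>n. B n \<inter> space \<nu> \<in> sets \<nu>"
    and sep: "\<And>x y. x \<in> space \<nu> \<Longrightarrow> y \<in> space \<nu> \<Longrightarrow> (\<And>n. x \<in> B n \<longleftrightarrow> y \<in> B n) \<Longrightarrow> x = y"
  shows "Measurable.pred (\<nu> \<Otimes>\<^sub>M \<nu>) (\<lambda>p. fst p = snd p)"
proof -
  note [measurable] = meas
  have "Measurable.pred (\<nu> \<Otimes>\<^sub>M \<nu>)
      (\<lambda>p. \<forall>n. fst p \<in> B n \<inter> space \<nu> \<longleftrightarrow> snd p \<in> B n \<inter> space \<nu>)"
    by measurable
  moreover have "fst p = snd p \<longleftrightarrow> (\<forall>n. fst p \<in> B n \<inter> space \<nu> \<longleftrightarrow> snd p \<in> B n \<inter> space \<nu>)"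
    if "p \<in> space (\<nu> \<Otimes>\<^sub>M \<nu>)" for p
    using that sep[of "fst p" "snd p"] by (auto simp: space_pair_measure)
  ultimately show ?thesis
    by (subst measurable_cong) auto
qed

lemma finite_subset_UN_lessThan:
  fixes D :: "nat \<Rightarrow> 'a set"
  assumes "finite T" "T \<subseteq> (\<Union>k. D k)"
  shows "\<exists>K. T \<subseteq> (\<Union>k<K. D k)"
proof -
  from assms(2) have "\<forall>x\<in>T. \<exists>k. x \<in> D k" by auto
  then obtain \<kappa> where "\<And>x. x \<in> T \<Longrightarrow> x \<in> D (\<kappa> x)" by metis
  moreover have "\<kappa> x < Suc (Max (\<kappa> ` T))" if "x \<in> T" for x
    using assms(1) that by (simp add: less_Suc_eq_le)
  ultimately have "T \<subseteq> (\<Union>k<Suc (Max (\<kappa> ` T)). D k)" by blast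
  then show ?thesis ..
qed

text \<open>The product over the first \<open>K\<close> cells is \<open>s\<close> to the number of points in these cells. That number
stabilises if the union is finite and tends to \<open>\<infinity>\<close> otherwise, in agreement with
\<^term>\<open>enat_power s \<infinity> = 0\<close>.\<close>
lemma power_card_UN_tendsto:
  fixes D :: "nat \<Rightarrow> 'a set"
  assumes fin: "\<And>k. finite (D k)" and disj: "disjoint_family D" and s: "0 \<le> s" "s < 1"
  shows "(\<lambda>K. \<Prod>k<K. s ^ card (D k)) \<longlonglongrightarrow> enat_power s (ecard (\<Union>k. D k))"
proof -
  have prod_eq: "(\<Prod>k<K. s ^ card (D k)) = s ^ card (\<Union>k<K. D k)" for K
    using fin disj
    by (subst card_UN_disjoint) (auto simp: power_sum disjoint_family_on_def)
  have mono: "(\<Union>k<K. D k) \<subseteq> (\<Union>k<L. D k)" if "K \<le> L" for K L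
    using that by (intro UN_mono) auto
  have "(\<lambda>K. s ^ card (\<Union>k<K. D k)) \<longlonglongrightarrow> enat_power s (ecard (\<Union>k. D k))"
  proof (cases "finite (\<Union>k. D k)")
    case True
    then obtain K where K: "(\<Union>k. D k) \<subseteq> (\<Union>k<K. D k)"
      using finite_subset_UN_lessThan by blast
    have "s ^ card (\<Union>k<L. D k) = enat_power s (ecard (\<Union>k. D k))" if "L \<ge> K" for L
    proof -
      have "(\<Union>k<L. D k) = (\<Union>k. D k)"
        using K mono[OF that] by blast
      with True show ?thesis by (simp add: ecard_def)
    qed
    then show ?thesis
      by (intro tendsto_eventually) (auto simp: eventually_sequentially)
  next
    case False
    have "filterlim (\<lambda>K. card (\<Union>k<K. D k)) at_top sequentially"
      unfolding filterlim_at_top eventually_sequentially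
    proof
      fix m
      obtain T where T: "finite T" "card T = m" "T \<subseteq> (\<Union>k. D k)"
        using infinite_arbitrarily_large[OF False, of m] by blast
      then obtain K where K: "T \<subseteq> (\<Union>k<K. D k)"
        using finite_subset_UN_lessThan by blast
      have "m \<le> card (\<Union>k<L. D k)" if "L \<ge> K" for L
      proof -
        have "T \<subseteq> (\<Union>k<L. D k)"
          using K mono[OF that] by blast
        then show ?thesis
          using fin T(2) by (auto intro!: card_mono)
      qed
      then show "\<exists>K. \<forall>L\<ge>K. m \<le> card (\<Union>k<L. D k)" by blast
    qed
    moreover have "(\<lambda>n. s ^ n) \<longlonglongrightarrow> 0"
      using s by (intro LIMSEQ_power_zero) auto
    ultimately have "(\<lambda>K. s ^ card (\<Union>k<K. D k)) \<longlonglongrightarrow> 0"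
      by (rule filterlim_compose[rotated])
    with False show ?thesis by (simp add: ecard_def)
  qed
  then show ?thesis by (simp only: prod_eq)
qed

lemma locally_finite_set:
  assumes "Hausdorff_space \<tau>" "F \<subseteq> topspace \<tau>"
    and fin: "\<And>x. x \<in> topspace \<tau> \<Longrightarrow> \<exists>U. openin \<tau> U \<and> x \<in> U \<and> finite (F \<inter> U)"
  shows "closedin \<tau> F" and "isolated_points \<tau> F = F"
proof -
  have remove: "openin \<tau> (U - S)" if "openin \<tau> U" "finite (F \<inter> U)" "S \<subseteq> F \<inter> U" for U S
  proof (rule openin_diff[OF that(1)])
    have "S \<subseteq> topspace \<tau>" "finite S"
      using that assms(2) finite_subset[OF that(3,2)] by auto
    then show "closedin \<tau> S"
      using Hausdorff_imp_t1_space[OF assms(1)] by (simp add: t1_space_closedin_finite)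
  qed
  show "closedin \<tau> F"
    unfolding closedin_def
  proof (intro conjI assms(2))
    show "openin \<tau> (topspace \<tau> - F)"
    proof (subst openin_subopen, safe)
      fix x assume x: "x \<in> topspace \<tau>" "x \<notin> F"
      obtain U where U: "openin \<tau> U" "x \<in> U" "finite (F \<inter> U)"
        using fin[OF x(1)] by blast
      have "openin \<tau> (U - F \<inter> U)" "x \<in> U - F \<inter> U" "U - F \<inter> U \<subseteq> topspace \<tau> - F"
        using remove[OF U(1,3)] x U(2) openin_subset[OF U(1)] by auto
      then show "\<exists>T. openin \<tau> T \<and> x \<in> T \<and> T \<subseteq> topspace \<tau> - F" by blast
    qed
  qed
  show "isolated_points \<tau> F = F"
  proof (intro equalityI isolated_points_subset subsetI)
    fix x assume x: "x \<in> F"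
    then obtain U where U: "openin \<tau> U" "x \<in> U" "finite (F \<inter> U)"
      using fin assms(2) by blast
    have "openin \<tau> (U - (F \<inter> U - {x}))"
      by (rule remove[OF U(1,3)]) auto
    moreover have "F \<inter> (U - (F \<inter> U - {x})) = {x}" using x U(2) by auto
    ultimately show "x \<in> isolated_points \<tau> F"
      unfolding isolated_points_def by auto
  qed
qed

lemma non_atomic_singleton:
  assumes "non_atomic N" "{x} \<in> sets N"
  shows "emeasure N {x} = 0"
proof (rule ccontr)
  assume "emeasure N {x} \<noteq> 0"
  moreover have "emeasure N B = 0 \<or> emeasure N ({x} - B) = 0" if "B \<subseteq> {x}" for B
    using that by (auto simp: subset_singleton_iff)
  ultimately have "measure_atom N {x}"
    using assms(2) by (auto simp: measure_atom_def zero_less_iff_neq_zero)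
  with assms(1) show False by (auto simp: non_atomic_def)
qed

text \<open>The countable separating family \<open>B\<close> makes the diagonal measurable on every cell, as required by
\<open>poisson_sample\<close>.\<close>
lemma poisson_sample_on:
  fixes N :: "'a measure" and B :: "nat \<Rightarrow> 'a set"
  assumes X: "X \<in> sets N" "emeasure N X < \<infinity>"
    and diffuse: "\<And>x. x \<in> space N \<Longrightarrow> {x} \<in> sets N \<and> emeasure N {x} = 0"
    and meas: "\<And>n. B n \<in> sets N"
    and sep: "\<And>x y. x \<in> space N \<Longrightarrow> y \<in> space N \<Longrightarrow> (\<And>n. x \<in> B n \<longleftrightarrow> y \<in> B n) \<Longrightarrow> x = y"
  obtains \<Omega> :: "(nat \<times> (nat \<Rightarrow> 'a)) measure" and P :: "nat \<times> (nat \<Rightarrow> 'a) \<Rightarrow> 'a set"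
  where "prob_space \<Omega>" "\<And>\<omega>. \<omega> \<in> space \<Omega> \<Longrightarrow> finite (P \<omega>) \<and> P \<omega> \<subseteq> X"
    "\<And>A. A \<in> sets N \<Longrightarrow> (\<lambda>\<omega>. card (P \<omega> \<inter> A)) \<in> measurable \<Omega> (count_space UNIV)"
    "\<And>A s. A \<in> sets N \<Longrightarrow> 0 \<le> s \<Longrightarrow> s \<le> 1 \<Longrightarrow>
       (\<integral>\<^sup>+\<omega>. ennreal (s ^ card (P \<omega> \<inter> A)) \<partial>\<Omega>) = ennreal (exp (- (1 - s) * measure N (A \<inter> X)))"
proof -
  let ?\<nu> = "restrict_space N X"
  have XN: "X \<subseteq> space N" using sets.sets_into_space[OF X(1)] .
  have [simp]: "space ?\<nu> = X" using XN by (auto simp: space_restrict_space)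
  have em: "emeasure ?\<nu> A = emeasure N A" if "A \<subseteq> X" for A
    using that X(1) XN by (subst emeasure_restrict_space) (auto simp: Int_absorb2)
  have inter: "A \<inter> X \<in> sets ?\<nu>" if "A \<in> sets N" for A
    using that by (auto simp: sets_restrict_space)
  show thesis
  proof (rule poisson_sample[of ?\<nu>])
    show "finite_measure ?\<nu>"
      by (rule finite_measureI) (use X(2) em[of X] in auto)
    show "emeasure ?\<nu> {x} = 0" if "x \<in> space ?\<nu>" for x
      using that diffuse[of x] em[of "{x}"] XN by auto
    show "Measurable.pred (?\<nu> \<Otimes>\<^sub>M ?\<nu>) (\<lambda>p. fst p = snd p)"
    proof (rule pred_diagonal[where B=B])
      show "B n \<inter> space ?\<nu> \<in> sets ?\<nu>" for n using inter meas by simp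
      show "x = y" if "x \<in> space ?\<nu>" "y \<in> space ?\<nu>" "\<And>n. x \<in> B n \<longleftrightarrow> y \<in> B n" for x y
        by (rule sep) (use that XN in auto)
    qed
    fix \<Omega> :: "(nat \<times> (nat \<Rightarrow> 'a)) measure" and P :: "nat \<times> (nat \<Rightarrow> 'a) \<Rightarrow> 'a set"
    assume \<Omega>: "prob_space \<Omega>"
      and fin: "\<And>\<omega>. \<omega> \<in> space \<Omega> \<Longrightarrow> finite (P \<omega>) \<and> P \<omega> \<subseteq> space ?\<nu>"
      and mc: "\<And>A. A \<in> sets ?\<nu> \<Longrightarrow> (\<lambda>\<omega>. card (P \<omega> \<inter> A)) \<in> measurable \<Omega> (count_space UNIV)"
      and int: "\<And>A s. A \<in> sets ?\<nu> \<Longrightarrow> 0 \<le> s \<Longrightarrow> s \<le> 1 \<Longrightarrow>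
        (\<integral>\<^sup>+\<omega>. ennreal (s ^ card (P \<omega> \<inter> A)) \<partial>\<Omega>) = ennreal (exp (- (1 - s) * measure ?\<nu> A))"
    have eq: "P \<omega> \<inter> (A \<inter> X) = P \<omega> \<inter> A" if "\<omega> \<in> space \<Omega>" for \<omega> A
      using fin[OF that] by auto
    show thesis
    proof (rule that[OF \<Omega>])
      show "finite (P \<omega>) \<and> P \<omega> \<subseteq> X" if "\<omega> \<in> space \<Omega>" for \<omega>
        using fin[OF that] by simp
      fix A assume A: "A \<in> sets N"
      show "(\<lambda>\<omega>. card (P \<omega> \<inter> A)) \<in> measurable \<Omega> (count_space UNIV)"
        using mc[OF inter[OF A]] by (rule measurable_cong[THEN iffD1, rotated]) (simp add: eq)
      fix s :: real assume s: "0 \<le> s" "s \<le> 1"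
      have "(\<integral>\<^sup>+\<omega>. ennreal (s ^ card (P \<omega> \<inter> A)) \<partial>\<Omega>) =
          (\<integral>\<^sup>+\<omega>. ennreal (s ^ card (P \<omega> \<inter> (A \<inter> X))) \<partial>\<Omega>)"
        by (intro nn_integral_cong) (simp add: eq)
      also have "\<dots> = ennreal (exp (- (1 - s) * measure N (A \<inter> X)))"
        using int[OF inter[OF A] s] em[of "A \<inter> X"] by (simp add: measure_def)
      finally show "(\<integral>\<^sup>+\<omega>. ennreal (s ^ card (P \<omega> \<inter> A)) \<partial>\<Omega>) =
          ennreal (exp (- (1 - s) * measure N (A \<inter> X)))" .
    qed
  qed
qed

lemma exp_partial_measure_tendsto:
  fixes N :: "'a measure" and X :: "nat \<Rightarrow> 'a set"
  assumes X: "\<And>k. X k \<in> sets N" "disjoint_family X" "(\<Union>k. X k) = space N"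
    and fin: "\<And>k. emeasure N (X k) < \<infinity>" and A: "A \<in> sets N" and s: "s < 1"
  shows "(\<lambda>K. ennreal (exp (- (1 - s) * (\<Sum>k<K. measure N (A \<inter> X k))))) \<longlonglongrightarrow>
    (if emeasure N A = \<infinity> then 0 else ennreal (exp (- (1 - s) * enn2real (emeasure N A))))"
proof -
  let ?S = "\<lambda>K. \<Sum>k<K. measure N (A \<inter> X k)"
  have em: "emeasure N (A \<inter> X k) = ennreal (measure N (A \<inter> X k))" for k
  proof -
    have "emeasure N (A \<inter> X k) \<le> emeasure N (X k)"
      using X(1) by (intro emeasure_mono) auto
    then have "emeasure N (A \<inter> X k) \<noteq> \<infinity>"
      using fin[of k] by (auto simp: top_unique)
    then show ?thesis by (simp add: emeasure_eq_ennreal_measure)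
  qed
  have UA: "(\<Union>k. A \<inter> X k) = A"
    using X(3) sets.sets_into_space[OF A] by blast
  have "(\<lambda>k. emeasure N (A \<inter> X k)) sums (\<Sum>k. emeasure N (A \<inter> X k))"
    by (rule summable_sums) simp
  also have "(\<Sum>k. emeasure N (A \<inter> X k)) = emeasure N A"
    using X A UA by (subst suminf_emeasure) (auto simp: disjoint_family_on_def)
  finally have lim: "(\<lambda>K. ennreal (?S K)) \<longlonglongrightarrow> emeasure N A"
    by (simp add: sums_def em sum_ennreal)
  show ?thesis
  proof (cases "emeasure N A = \<infinity>")
    case True
    with lim have "filterlim ?S at_top sequentially"
      by (simp add: ennreal_tendsto_top_eq_at_top)
    then have "filterlim (\<lambda>K. - (1 - s) * ?S K) at_bot sequentially"
      using s by (intro filterlim_tendsto_neg_mult_at_bot[OF tendsto_const]) auto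
    then have "(\<lambda>K. exp (- (1 - s) * ?S K)) \<longlonglongrightarrow> 0"
      by (rule filterlim_compose[OF exp_at_bot])
    then show ?thesis
      using True tendsto_ennrealI by fastforce
  next
    case False
    then have "emeasure N A = ennreal (enn2real (emeasure N A))"
      by (simp add: less_top)
    then have "(\<lambda>K. ennreal (?S K)) \<longlonglongrightarrow> ennreal (enn2real (emeasure N A))"
      using lim by (rule subst[where P="\<lambda>c. (\<lambda>K. ennreal (?S K)) \<longlonglongrightarrow> c"])
    then have "?S \<longlonglongrightarrow> enn2real (emeasure N A)"
      by (rule tendsto_ennrealD) (auto intro!: always_eventually sum_nonneg)
    then have "(\<lambda>K. ennreal (exp (- (1 - s) * ?S K))) \<longlonglongrightarrow>
        ennreal (exp (- (1 - s) * enn2real (emeasure N A)))"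
      by (intro tendsto_intros tendsto_ennrealI)
    with False show ?thesis by simp
  qed
qed

context countably_based_hausdorff
begin

lemma base_separates:
  assumes "x \<in> topspace \<tau>" "y \<in> topspace \<tau>" "\<And>n. x \<in> b n \<longleftrightarrow> y \<in> b n"
  shows "x = y"
proof (rule ccontr)
  assume "x \<noteq> y"
  then obtain U V where UV: "openin \<tau> U" "x \<in> U" "y \<in> V" "disjnt U V"
    using hausdorff assms(1,2) unfolding Hausdorff_space_def by metis
  from base[OF UV(1,2)] obtain n where "x \<in> b n" "b n \<subseteq> U" by blast
  with assms(3) UV show False by (auto simp: disjnt_def)
qed

text \<open>In the proof, \<open>X k\<close> are the cells, \<open>\<Theta>\<close> is the product of the probability spaces \<open>\<Omega> k\<close> on which the
samples \<open>P k\<close> of the cells live, and \<open>F\<close> is the union of the samples. Its law is the required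
random closed set.\<close>
lemma poisson_process_exists:
  assumes sets_N: "sets N = sigma_sets (topspace \<tau>) {U. openin \<tau> U}"
    and na: "non_atomic N" and lf: "locally_finite_measure \<tau> N"
  shows "\<exists>R. random_closed_set \<tau> R \<and> poisson_point_process R N (point_count \<tau>)"
proof -
  have space_N: "space N = topspace \<tau>"
  proof -
    have "{U. openin \<tau> U} \<subseteq> Pow (topspace \<tau>)" using openin_subset by auto
    then have "sets N = sets (sigma (topspace \<tau>) {U. openin \<tau> U})"
      "space (sigma (topspace \<tau>) {U. openin \<tau> U}) = topspace \<tau>"
      by (simp_all add: sets_N)
    then show ?thesis using sets_eq_imp_space_eq by blast
  qed
  have open_N: "U \<in> sets N" if "openin \<tau> U" for U
    using that by (auto simp: sets_N intro: sigma_sets.Basic)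
  have diffuse: "{x} \<in> sets N \<and> emeasure N {x} = 0" if x: "x \<in> space N" for x
  proof -
    have "closedin \<tau> {x}"
      using Hausdorff_imp_t1_space[OF hausdorff] x by (simp add: t1_space_closedin_finite space_N)
    then have "space N - (space N - {x}) \<in> sets N"
      by (intro sets.compl_sets open_N) (simp add: closedin_def space_N)
    also have "space N - (space N - {x}) = {x}" using x by auto
    finally show ?thesis using non_atomic_singleton[OF na] by blast
  qed
  \<comment> \<open>The base sets of finite measure already cover the space.\<close>
  define W where "W n = (if emeasure N (b n) < \<infinity> then b n else {})" for n
  have W: "openin \<tau> (W n)" "W n \<in> sets N" "emeasure N (W n) < \<infinity>" for n
    using open_base[of n] open_N by (auto simp: W_def)
  have cover: "\<exists>n. x \<in> W n" if x: "x \<in> topspace \<tau>" for x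
  proof -
    obtain U where U: "openin \<tau> U" "x \<in> U" "emeasure N U < \<infinity>"
      using lf x unfolding locally_finite_measure_def by blast
    from base[OF U(1,2)] obtain n where n: "x \<in> b n" "b n \<subseteq> U" by blast
    have "emeasure N (b n) < \<infinity>"
      using emeasure_mono[OF n(2) open_N[OF U(1)]] U(3) by (rule le_less_trans)
    with n show ?thesis by (auto simp: W_def)
  qed
  define X where "X = disjointed W"
  have X_sets: "X k \<in> sets N" for k
    using sets.range_disjointed_sets[of W N] W(2) by (auto simp: X_def)
  have X_disj: "disjoint_family X" by (simp add: X_def disjoint_family_disjointed)
  have X_W: "X k \<subseteq> W k" for k by (simp add: X_def disjointed_subset)
  have X_UN: "(\<Union>k. X k) = space N"
    unfolding X_def UN_disjointed_eq space_N using cover openin_subset[OF W(1)] by blast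
  have X_fin: "emeasure N (X k) < \<infinity>" for k
    using emeasure_mono[OF X_W[of k] W(2)] W(3)[of k] by (rule le_less_trans)
  have "\<exists>(\<Omega> :: (nat \<times> (nat \<Rightarrow> 'a)) measure) P. prob_space \<Omega> \<and>
      (\<forall>\<omega>\<in>space \<Omega>. finite (P \<omega>) \<and> P \<omega> \<subseteq> X k) \<and>
      (\<forall>A\<in>sets N. (\<lambda>\<omega>. card (P \<omega> \<inter> A)) \<in> measurable \<Omega> (count_space UNIV)) \<and>
      (\<forall>A\<in>sets N. \<forall>s. 0 \<le> s \<longrightarrow> s \<le> 1 \<longrightarrow>
        (\<integral>\<^sup>+\<omega>. ennreal (s ^ card (P \<omega> \<inter> A)) \<partial>\<Omega>) = ennreal (exp (- (1 - s) * measure N (A \<inter> X k))))"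
    for k
  proof (rule poisson_sample_on[OF X_sets[of k] X_fin[of k], where B=b])
    show "b n \<in> sets N" for n by (rule open_N[OF open_base])
    show "x = y" if "x \<in> space N" "y \<in> space N" "\<And>n. x \<in> b n \<longleftrightarrow> y \<in> b n" for x y
      using that by (intro base_separates) (simp_all add: space_N)
    fix \<Omega> :: "(nat \<times> (nat \<Rightarrow> 'a)) measure" and P :: "nat \<times> (nat \<Rightarrow> 'a) \<Rightarrow> 'a set"
    assume o: "prob_space \<Omega>" "\<And>\<omega>. \<omega> \<in> space \<Omega> \<Longrightarrow> finite (P \<omega>) \<and> P \<omega> \<subseteq> X k"
      "\<And>A. A \<in> sets N \<Longrightarrow> (\<lambda>\<omega>. card (P \<omega> \<inter> A)) \<in> measurable \<Omega> (count_space UNIV)"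
      "\<And>A s. A \<in> sets N \<Longrightarrow> 0 \<le> s \<Longrightarrow> s \<le> 1 \<Longrightarrow>
        (\<integral>\<^sup>+\<omega>. ennreal (s ^ card (P \<omega> \<inter> A)) \<partial>\<Omega>) = ennreal (exp (- (1 - s) * measure N (A \<inter> X k)))"
    show ?thesis
      by (intro exI[of _ \<Omega>] exI[of _ P] conjI[OF _ conjI[OF _ conjI]] ballI allI impI o)
  qed (rule diffuse)
  then obtain \<Omega> :: "nat \<Rightarrow> (nat \<times> (nat \<Rightarrow> 'a)) measure" and P
    where \<Omega>: "\<And>k. prob_space (\<Omega> k)"
      and fin: "\<And>k \<omega>. \<omega> \<in> space (\<Omega> k) \<Longrightarrow> finite (P k \<omega>) \<and> P k \<omega> \<subseteq> X k"
      and meas: "\<And>k A. A \<in> sets N \<Longrightarrow> (\<lambda>\<omega>. card (P k \<omega> \<inter> A)) \<in> measurable (\<Omega> k) (count_space UNIV)"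
      and int_card: "\<And>k A s. A \<in> sets N \<Longrightarrow> 0 \<le> s \<Longrightarrow> s \<le> 1 \<Longrightarrow>
        (\<integral>\<^sup>+\<omega>. ennreal (s ^ card (P k \<omega> \<inter> A)) \<partial>\<Omega> k) =
          ennreal (exp (- (1 - s) * measure N (A \<inter> X k)))"
    by metis
  define \<Theta> where "\<Theta> = PiM UNIV \<Omega>"
  interpret \<Theta>: prob_space \<Theta>
    unfolding \<Theta>_def by (intro prob_space_PiM \<Omega>)
  define F where "F \<omega> = (\<Union>k. P k (\<omega> k))" for \<omega>
  have coord: "\<omega> k \<in> space (\<Omega> k)" if "\<omega> \<in> space \<Theta>" for \<omega> k
    using that by (auto simp: \<Theta>_def space_PiM PiE_iff)
  have [measurable]: "(\<lambda>\<omega>. card (P k (\<omega> k) \<inter> A)) \<in> measurable \<Theta> (count_space UNIV)"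
    if "A \<in> sets N" for k A
    unfolding \<Theta>_def by (rule measurable_compose[OF measurable_component_singleton[of k UNIV \<Omega>] meas[OF that]]) simp
  have F_top: "F \<omega> \<subseteq> topspace \<tau>" if "\<omega> \<in> space \<Theta>" for \<omega>
    using fin[OF coord[OF that]] X_UN space_N unfolding F_def by blast
  \<comment> \<open>The cells after the \<open>n\<close>-th one are disjoint from \<open>W n\<close>.\<close>
  have F_W: "finite (F \<omega> \<inter> W n)" if "\<omega> \<in> space \<Theta>" for \<omega> n
  proof (rule finite_subset)
    show "finite (\<Union>k\<le>n. P k (\<omega> k))"
      using fin[OF coord[OF that]] by auto
    show "F \<omega> \<inter> W n \<subseteq> (\<Union>k\<le>n. P k (\<omega> k))"
    proof
      fix x assume x: "x \<in> F \<omega> \<inter> W n"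
      then obtain k where k: "x \<in> P k (\<omega> k)" by (auto simp: F_def)
      then have "x \<in> X k" using fin[OF coord[OF that]] by blast
      with x have "k \<le> n"
        unfolding X_def disjointed_def by (metis DiffD2 IntD2 UN_I atLeastLessThan_iff le0 not_le_imp_less)
      with k show "x \<in> (\<Union>k\<le>n. P k (\<omega> k))" by blast
    qed
  qed
  have loc: "\<exists>U. openin \<tau> U \<and> x \<in> U \<and> finite (F \<omega> \<inter> U)"
    if "\<omega> \<in> space \<Theta>" "x \<in> topspace \<tau>" for \<omega> x
    using cover[OF that(2)] W(1) F_W[OF that(1)] by blast
  have F_closed: "closedin \<tau> (F \<omega>)" and F_iso: "isolated_points \<tau> (F \<omega>) = F \<omega>"
    if "\<omega> \<in> space \<Theta>" for \<omega>
    using locally_finite_set[OF hausdorff F_top[OF that] loc[OF that]] by auto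
  have F_dense: "isolated_points_dense \<tau> (F \<omega>)" if "\<omega> \<in> space \<Theta>" for \<omega>
    using F_iso[OF that] by (simp add: isolated_points_dense_def)
  have count: "point_count \<tau> A (F \<omega>) = ecard (F \<omega> \<inter> A)" if "\<omega> \<in> space \<Theta>" for \<omega> A
    using F_dense[OF that] F_iso[OF that] by (simp add: point_count_def)
  have F_meas: "F \<in> measurable \<Theta> (effros \<tau>)"
    unfolding effros_def
  proof (rule measurable_measure_of)
    show "F \<in> space \<Theta> \<rightarrow> {F. closedin \<tau> F}" using F_closed by auto
    fix S assume "S \<in> {B. \<exists>U. openin \<tau> U \<and> B = {F. closedin \<tau> F \<and> F \<inter> U \<noteq> {}}}"
    then obtain U where U: "openin \<tau> U" "S = {F. closedin \<tau> F \<and> F \<inter> U \<noteq> {}}" by blast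
    note [measurable] = open_N[OF U(1)]
    have "{\<omega> \<in> space \<Theta>. \<exists>k. card (P k (\<omega> k) \<inter> U) \<noteq> 0} \<in> sets \<Theta>"
      by measurable
    also have "{\<omega> \<in> space \<Theta>. \<exists>k. card (P k (\<omega> k) \<inter> U) \<noteq> 0} = F -` S \<inter> space \<Theta>"
    proof -
      have "(\<exists>k. card (P k (\<omega> k) \<inter> U) \<noteq> 0) \<longleftrightarrow> F \<omega> \<in> S" if "\<omega> \<in> space \<Theta>" for \<omega>
      proof -
        have "card (P k (\<omega> k) \<inter> U) \<noteq> 0 \<longleftrightarrow> P k (\<omega> k) \<inter> U \<noteq> {}" for k
          using fin[OF coord[OF that]] by simp
        moreover have "F \<omega> \<inter> U \<noteq> {} \<longleftrightarrow> (\<exists>k. P k (\<omega> k) \<inter> U \<noteq> {})"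
          unfolding F_def by blast
        ultimately show ?thesis
          using F_closed[OF that] by (simp add: U(2))
      qed
      then show ?thesis by blast
    qed
    finally show "F -` S \<inter> space \<Theta> \<in> sets \<Theta>" .
  qed auto
  have pc_meas: "point_count \<tau> A \<in> measurable (effros \<tau>) (count_space UNIV)" if "A \<in> sets N" for A
    using that by (intro measurable_point_count) (simp add: sets_N)
  define R where "R = distr \<Theta> (effros \<tau>) F"
  have R: "prob_space R" unfolding R_def by (rule \<Theta>.prob_space_distr[OF F_meas])
  have distribution: "distr R (count_space UNIV) (point_count \<tau> A) = measure_pmf (Poiss (emeasure N A))"
    if A: "A \<in> sets N" for A
  proof (rule pgf_inject)
    have comp: "point_count \<tau> A \<circ> F \<in> measurable \<Theta> (count_space UNIV)"
      using F_meas pc_meas[OF A] by (rule measurable_comp)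
    have distr: "distr R (count_space UNIV) (point_count \<tau> A) =
        distr \<Theta> (count_space UNIV) (point_count \<tau> A \<circ> F)"
      unfolding R_def using pc_meas[OF A] F_meas by (simp add: distr_distr)
    show "prob_space (distr R (count_space UNIV) (point_count \<tau> A))"
      unfolding distr by (rule \<Theta>.prob_space_distr[OF comp])
    fix s :: real assume s: "0 \<le> s" "s < 1"
    have lim: "(\<lambda>K. \<integral>\<^sup>+\<omega>. ennreal (\<Prod>k<K. s ^ card (P k (\<omega> k) \<inter> A)) \<partial>\<Theta>) \<longlonglongrightarrow>
        (\<integral>\<^sup>+\<omega>. ennreal (enat_power s (ecard (F \<omega> \<inter> A))) \<partial>\<Theta>)"
    proof (rule nn_integral_dominated_convergence[where w="\<lambda>_. 1"])
      show "AE \<omega> in \<Theta>. (\<lambda>K. ennreal (\<Prod>k<K. s ^ card (P k (\<omega> k) \<inter> A))) \<longlonglongrightarrow>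
          ennreal (enat_power s (ecard (F \<omega> \<inter> A)))"
      proof (rule AE_I2)
        fix \<omega> assume \<omega>: "\<omega> \<in> space \<Theta>"
        have "finite (P k (\<omega> k) \<inter> A)" for k using fin[OF coord[OF \<omega>]] by blast
        moreover have "disjoint_family (\<lambda>k. P k (\<omega> k) \<inter> A)"
          using fin[OF coord[OF \<omega>]] X_disj unfolding disjoint_family_on_def by blast
        ultimately have "(\<lambda>K. \<Prod>k<K. s ^ card (P k (\<omega> k) \<inter> A)) \<longlonglongrightarrow>
            enat_power s (ecard (\<Union>k. P k (\<omega> k) \<inter> A))"
          using s by (rule power_card_UN_tendsto)
        moreover have "(\<Union>k. P k (\<omega> k) \<inter> A) = F \<omega> \<inter> A" by (auto simp: F_def)
        ultimately show "(\<lambda>K. ennreal (\<Prod>k<K. s ^ card (P k (\<omega> k) \<inter> A))) \<longlonglongrightarrow>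
          ennreal (enat_power s (ecard (F \<omega> \<inter> A)))"
          by (intro tendsto_ennrealI) simp
      qed
      have "(\<lambda>\<omega>. ennreal (enat_power s (point_count \<tau> A (F \<omega>)))) \<in> borel_measurable \<Theta>"
        using measurable_compose[OF comp, of "\<lambda>n. ennreal (enat_power s n)"] by simp
      then show "(\<lambda>\<omega>. ennreal (enat_power s (ecard (F \<omega> \<inter> A)))) \<in> borel_measurable \<Theta>"
        by (subst measurable_cong) (auto simp: count)
      show "(\<lambda>\<omega>. ennreal (\<Prod>k<K. s ^ card (P k (\<omega> k) \<inter> A))) \<in> borel_measurable \<Theta>" for K
        using A by measurable
      show "AE \<omega> in \<Theta>. ennreal (\<Prod>k<K. s ^ card (P k (\<omega> k) \<inter> A)) \<le> 1" for K
        using s by (intro AE_I2) (auto intro!: prod_le_1 power_le_one)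
    qed (auto simp: \<Theta>.emeasure_space_1)
    have partial: "(\<integral>\<^sup>+\<omega>. ennreal (\<Prod>k<K. s ^ card (P k (\<omega> k) \<inter> A)) \<partial>\<Theta>) =
        ennreal (exp (- (1 - s) * (\<Sum>k<K. measure N (A \<inter> X k))))" for K
    proof -
      have "(\<integral>\<^sup>+\<omega>. ennreal (\<Prod>k<K. s ^ card (P k (\<omega> k) \<inter> A)) \<partial>\<Theta>) =
          (\<integral>\<^sup>+\<omega>. (\<Prod>k<K. ennreal (s ^ card (P k (\<omega> k) \<inter> A))) \<partial>PiM UNIV \<Omega>)"
        unfolding \<Theta>_def using s by (simp add: prod_ennreal)
      also have "\<dots> = (\<Prod>k<K. \<integral>\<^sup>+x. ennreal (s ^ card (P k x \<inter> A)) \<partial>\<Omega> k)"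
        using meas[OF A] by (intro nn_integral_PiM_prod \<Omega>) auto
      also have "\<dots> = ennreal (\<Prod>k<K. exp (- (1 - s) * measure N (A \<inter> X k)))"
        using s by (simp add: int_card[OF A] prod_ennreal)
      also have "(\<Prod>k<K. exp (- (1 - s) * measure N (A \<inter> X k))) =
          exp (- (1 - s) * (\<Sum>k<K. measure N (A \<inter> X k)))"
        by (simp only: exp_sum[symmetric] finite_lessThan sum_distrib_left)
      finally show ?thesis .
    qed
    have "(\<integral>\<^sup>+\<omega>. ennreal (enat_power s (ecard (F \<omega> \<inter> A))) \<partial>\<Theta>) =
        (if emeasure N A = \<infinity> then 0 else ennreal (exp (- (1 - s) * enn2real (emeasure N A))))"
      by (rule LIMSEQ_unique[OF lim[unfolded partial]
            exp_partial_measure_tendsto[OF X_sets X_disj X_UN X_fin A s(2)]])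
    also have "\<dots> = pgf (measure_pmf (Poiss (emeasure N A))) s"
      by (simp only: pgf_Poiss[OF s])
    also have "(\<integral>\<^sup>+\<omega>. ennreal (enat_power s (ecard (F \<omega> \<inter> A))) \<partial>\<Theta>) =
        pgf (distr R (count_space UNIV) (point_count \<tau> A)) s"
      unfolding pgf_def distr using comp by (subst nn_integral_distr) (auto simp: count cong: nn_integral_cong)
    finally show "pgf (distr R (count_space UNIV) (point_count \<tau> A)) s =
      pgf (measure_pmf (Poiss (emeasure N A))) s" .
  qed (auto simp: prob_space_measure_pmf)
  have "AE S in R. isolated_points_dense \<tau> S"
    unfolding R_def using F_meas F_dense
    by (subst AE_distr_iff) (use pred_isolated_points_dense in \<open>auto simp: pred_def\<close>)
  then have "AE S in R. point_count \<tau> (A \<union> B) S = point_count \<tau> A S + point_count \<tau> B S"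
    if "A \<inter> B = {}" for A B
  proof eventually_elim
    case (elim S)
    have "isolated_points \<tau> S \<inter> A \<inter> (isolated_points \<tau> S \<inter> B) = {}" using that by blast
    from ecard_Un_disjoint[OF this] elim show ?case
      by (simp add: point_count_def Int_Un_distrib)
  qed
  moreover have "point_count \<tau> A \<in> measurable R (count_space UNIV)" if "A \<in> sets N" for A
    using pc_meas[OF that] by (simp add: R_def)
  ultimately have "poisson_point_process R N (point_count \<tau>)"
    using R distribution by (simp add: poisson_point_process_def)
  moreover have "random_closed_set \<tau> R"
    using R by (simp add: random_closed_set_def R_def)
  ultimately show ?thesis by blast
qed

end

section \<open>Existence and uniqueness of the Poisson random closed set\<close>

theorem theorem3:
  fixes M :: "'a measure"
  assumes "standard_borel M"
  shows "\<forall>\<tau>. polish_topology \<tau> \<and> generates_sigma_algebra \<tau> M \<longrightarrow>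
    (\<exists>\<Xi> :: 'a set \<Rightarrow> 'a set \<Rightarrow> enat.
       (\<forall>A\<in>sets M. \<Xi> A \<in> measurable (effros \<tau>) (count_space UNIV)) \<and>
       (\<forall>N :: 'a measure.
          sets N = sets M \<and> non_atomic N \<and> locally_finite_measure \<tau> N \<longrightarrow>
          (\<exists>!R. random_closed_set \<tau> R \<and> poisson_point_process R N \<Xi>)))"
proof (intro allI impI, elim conjE)
  fix \<tau> :: "'a topology"
  assume polish: "polish_topology \<tau>" and gen: "generates_sigma_algebra \<tau> M"
  obtain b where "countably_based_hausdorff \<tau> b"
    using polish_countably_based[OF polish] .
  then interpret countably_based_hausdorff \<tau> b .
  have sets_M: "sets M = sigma_sets (topspace \<tau>) {U. openin \<tau> U}"
    using gen by (simp add: generates_sigma_algebra_def)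
  show "\<exists>\<Xi> :: 'a set \<Rightarrow> 'a set \<Rightarrow> enat.
       (\<forall>A\<in>sets M. \<Xi> A \<in> measurable (effros \<tau>) (count_space UNIV)) \<and>
       (\<forall>N :: 'a measure.
          sets N = sets M \<and> non_atomic N \<and> locally_finite_measure \<tau> N \<longrightarrow>
          (\<exists>!R. random_closed_set \<tau> R \<and> poisson_point_process R N \<Xi>))"
  proof (intro exI[of _ "point_count \<tau>"] conjI ballI allI impI, goal_cases)
    case (1 A)
    then show ?case by (intro measurable_point_count) (simp add: sets_M)
  next
    case (2 N)
    then have sets_N: "sets N = sigma_sets (topspace \<tau>) {U. openin \<tau> U}"
      by (simp add: sets_M)
    then have open_N: "U \<in> sets N" if "openin \<tau> U" for U
      using that by (auto intro: sigma_sets.Basic)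
    have "\<exists>R. random_closed_set \<tau> R \<and> poisson_point_process R N (point_count \<tau>)"
      using poisson_process_exists[OF sets_N] 2 by blast
    then show ?case
      using poisson_process_unique[where N=N] open_N by blast
  qed
qed

end
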